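(* Let $\mathcal{D}$ be a reliable digraph property, let $D$ be a digraph, let $L$ be a list assignment of $D$, and suppose that $(X,H)=C(D,L)$ is a $\mathcal{D}$-critical cover of $D$. If $B$ is a block of the low vertex subdigraph $D[V(D,X,H,\mathcal{D})]$, then $B$ is a $\mathcal{D}$-dibrick.
   Context: All digraphs are finite, without loops and without parallel arcs (digons allowed). For $v\in V(D)$, $d_D(v)=(d_D^+(v),d_D^-(v))$. Elements of $\mathbb{N}_0^2$ are compared, added and multiplied by nonnegative integers coordinatewise. $\Delta(D)=(\Delta^+(D),\Delta^-(D))$. A digraph is connected if its underlying graph is; a separating vertex of a connected digraph $D$ is $v$ with $D-v$ having at least two components; a block is a maximal connected subdigraph without a separating vertex. $D^\pm(G)$ is obtained from an undirected graph $G$ by replacing each edge by a digon. A digraph is Eulerian if $d^+(v)=d^-(v)$ for all vertices. A digraph property is a class of digraphs closed under isomorphism; reliable means: nontrivial (contains a nonempty digraph but not all digraphs), hereditary (closed under induced subdigraphs), additive (closed under disjoint unions). $\mathrm{CR}(\mathcal{D})$ is the set of digraphs $D\notin\mathcal{D}$ with $D-v\in\mathcal{D}$ for all $v$, and $d(\mathcal{D})=(d^+(\mathcal{D}),d^-(\mathcal{D}))$ where $d^\pm(\mathcal{D})=\min\{\delta^\pm(D):D\in\mathrm{CR}(\mathcal{D})\}$. A cover of $D$ is a pair $(X,H)$, $H$ a digraph disjoint from $D$, $X$ assigning to each $v\in V(D)$ a set $X_v\subseteq V(H)$, the $X_v$ pairwise disjoint with union $V(H)$, each $X_v$ independent in $H$,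 and for distinct $u,v$ the arcs of $H$ from $X_u$ to $X_v$ form a matching if $uv\in A(D)$ and there are none if $uv\notin A(D)$. A list assignment $L$ assigns to each vertex $v$ a set $L(v)$; $C(D,L)$ is the cover with $X_v=\{v\}\times L(v)$ in which $(u,c)(v,c')$ is an arc iff $uv\in A(D)$ and $c=c'$. Transversal: $T\subseteq V(H)$ with $|T\cap X_v|=1$ for all $v$; partial transversal: $|T\cap X_v|\le1$; $\mathrm{dom}(T:D)=\{v:X_v\cap T\ne\varnothing\}$. A $\mathcal{D}$-transversal is a transversal $T$ with $H[T]\in\mathcal{D}$; a $(\mathcal{D},v)$-transversal is a partial transversal $T$ with $\mathrm{dom}(T:D)=V(D)\setminus\{v\}$ and $H[T]\in\mathcal{D}$. $(X,H)$ is $\mathcal{D}$-critical if it has no $\mathcal{D}$-transversal but a $(\mathcal{D},v)$-transversal for every $v$. $V(D,X,H,\mathcal{D})=\{v:d_D(v)=d(\mathcal{D})\cdot|X_v|\}$; $D[V(D,X,H,\mathcal{D})]$ is the low vertex subdigraph. A $\mathcal{D}$-dibrick is a connected digraph $B$ with $B=D^\pm(K_n)$, $n\ge1$, or $B=D^\pm(C_n)$, $n\ge3$ odd, or $B\in\mathcal{D}$ with $\Delta(B)\le d(\mathcal{D})$, or $B\in\mathrm{CR}(\mathcal{D})$ Eulerian with $d_B^+(v)=d_B^-(v)=d^+(\mathcal{D})=d^-(\mathcal{D})$ for all $v$. *)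

theory Defs
  imports "Graph_Theory.Digraph_Component" "Graph_Theory.Digraph_Isomorphism"
begin

section \<open>Digraph properties\<close>

text \<open>
  The locale \<^locale>\<open>digraph\<close> describes the finite digraphs without loops and parallel arcs (digons
  and the null digraph are allowed). Every such digraph is isomorphic to one whose vertices are
  natural numbers, so an isomorphism-closed class of digraphs is represented by its members on
  \<^typ>\<open>nat\<close>; \<open>has_property\<close> extends membership to digraphs over arbitrary types.
\<close>

type_synonym digraph_property = "nat pair_pre_digraph set"

definition has_property :: "digraph_property \<Rightarrow> ('a, 'b) pre_digraph \<Rightarrow> bool" where
  "has_property P G \<longleftrightarrow> (\<exists>G' \<in> P. digraph_iso G (with_proj G'))"

definition is_digraph_property :: "digraph_property \<Rightarrow> bool" where
  "is_digraph_property P \<longleftrightarrow>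
     (\<forall>G \<in> P. digraph (with_proj G)) \<and>
     (\<forall>G \<in> P. \<forall>G'. digraph_iso (with_proj G) (with_proj G') \<longrightarrow> G' \<in> P)"

definition nontrivial :: "digraph_property \<Rightarrow> bool" where
  "nontrivial P \<longleftrightarrow>
     (\<exists>G \<in> P. pverts G \<noteq> {}) \<and> (\<exists>G. digraph (with_proj G) \<and> G \<notin> P)"

definition hereditary :: "digraph_property \<Rightarrow> bool" where
  "hereditary P \<longleftrightarrow>
     (\<forall>G \<in> P. \<forall>G'. induced_subgraph (with_proj G') (with_proj G) \<longrightarrow> G' \<in> P)"

definition additive :: "digraph_property \<Rightarrow> bool" where
  "additive P \<longleftrightarrow>
     (\<forall>G \<in> P. \<forall>H \<in> P. pverts G \<inter> pverts H = {} \<longrightarrow>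
        \<lparr>pverts = pverts G \<union> pverts H, parcs = parcs G \<union> parcs H\<rparr> \<in> P)"

definition reliable :: "digraph_property \<Rightarrow> bool" where
  "reliable P \<longleftrightarrow> is_digraph_property P \<and> nontrivial P \<and> hereditary P \<and> additive P"

definition CR :: "digraph_property \<Rightarrow> ('a, 'b) pre_digraph \<Rightarrow> bool" where
  "CR P G \<longleftrightarrow> digraph G \<and> \<not> has_property P G \<and>
     (\<forall>v \<in> verts G. has_property P (pre_digraph.del_vert G v))"


section \<open>Degrees\<close>

definition deg :: "('a, 'b) pre_digraph \<Rightarrow> 'a \<Rightarrow> nat \<times> nat" where
  "deg G v = (out_degree G v, in_degree G v)"

definition min_out_degree :: "('a, 'b) pre_digraph \<Rightarrow> nat" where
  "min_out_degree G = Min (out_degree G ` verts G)"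

definition min_in_degree :: "('a, 'b) pre_digraph \<Rightarrow> nat" where
  "min_in_degree G = Min (in_degree G ` verts G)"

definition max_out_degree :: "('a, 'b) pre_digraph \<Rightarrow> nat" where
  "max_out_degree G = Max (out_degree G ` verts G)"

definition max_in_degree :: "('a, 'b) pre_digraph \<Rightarrow> nat" where
  "max_in_degree G = Max (in_degree G ` verts G)"

text \<open>
  The degrees of a property; as isomorphic digraphs have the same degrees, ranging over the digraphs
  on \<^typ>\<open>nat\<close> loses nothing.
\<close>

definition d_out :: "digraph_property \<Rightarrow> nat" where
  "d_out P = (LEAST k. \<exists>G :: nat pair_pre_digraph.
     CR P (with_proj G) \<and> k = min_out_degree (with_proj G))"

definition d_in :: "digraph_property \<Rightarrow> nat" where
  "d_in P = (LEAST k. \<exists>G :: nat pair_pre_digraph.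
     CR P (with_proj G) \<and> k = min_in_degree (with_proj G))"

definition eulerian :: "('a, 'b) pre_digraph \<Rightarrow> bool" where
  "eulerian G \<longleftrightarrow> (\<forall>v \<in> verts G. out_degree G v = in_degree G v)"


section \<open>Blocks\<close>

text \<open>
  \<^const>\<open>connected\<close> refers to the underlying undirected graph and excludes the null digraph.
\<close>

definition components :: "('a, 'b) pre_digraph \<Rightarrow> ('a, 'b) pre_digraph set" where
  "components G = {C. pre_digraph.max_subgraph G connected C}"

definition separating_vertex :: "('a, 'b) pre_digraph \<Rightarrow> 'a \<Rightarrow> bool" where
  "separating_vertex G v \<longleftrightarrow>
     v \<in> verts G \<and> card (components (pre_digraph.del_vert G v)) \<ge> 2"

definition is_block :: "('a, 'b) pre_digraph \<Rightarrow> ('a, 'b) pre_digraph \<Rightarrow> bool" where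
  "is_block G B \<longleftrightarrow>
     pre_digraph.max_subgraph G (\<lambda>B'. connected B' \<and> (\<nexists>v. separating_vertex B' v)) B"


section \<open>Covers\<close>

definition arcs_between :: "('a, 'b) pre_digraph \<Rightarrow> 'a set \<Rightarrow> 'a set \<Rightarrow> 'b set" where
  "arcs_between G U W = {a \<in> arcs G. tail G a \<in> U \<and> head G a \<in> W}"

definition is_matching :: "('a, 'b) pre_digraph \<Rightarrow> 'b set \<Rightarrow> bool" where
  "is_matching G M \<longleftrightarrow> M \<subseteq> arcs G \<and>
     (\<forall>a \<in> M. \<forall>b \<in> M. a \<noteq> b \<longrightarrow> {tail G a, head G a} \<inter> {tail G b, head G b} = {})"

definition independent_set :: "('a, 'b) pre_digraph \<Rightarrow> 'a set \<Rightarrow> bool" where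
  "independent_set G S \<longleftrightarrow> S \<subseteq> verts G \<and> arcs_between G S S = {}"

text \<open>
  Disjointness of \<open>H\<close> and \<open>D\<close> is reflected by their vertices being of separate types. Values of
  \<open>X\<close> outside \<open>verts D\<close> are irrelevant.
\<close>

definition is_cover ::
    "('a, 'b) pre_digraph \<Rightarrow> ('a \<Rightarrow> 'h set) \<Rightarrow> ('h, 'k) pre_digraph \<Rightarrow> bool" where
  "is_cover D X H \<longleftrightarrow> digraph H \<and>
     (\<Union>v \<in> verts D. X v) = verts H \<and>
     (\<forall>u \<in> verts D. \<forall>v \<in> verts D. u \<noteq> v \<longrightarrow> X u \<inter> X v = {}) \<and>
     (\<forall>v \<in> verts D. independent_set H (X v)) \<and>
     (\<forall>u \<in> verts D. \<forall>v \<in> verts D. u \<noteq> v \<longrightarrow>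
        (if (u, v) \<in> arcs_ends D then is_matching H (arcs_between H (X u) (X v))
         else arcs_between H (X u) (X v) = {}))"

definition list_cover ::
    "('a, 'b) pre_digraph \<Rightarrow> ('a \<Rightarrow> 'c set) \<Rightarrow>
     ('a \<Rightarrow> ('a \<times> 'c) set) \<times> ('a \<times> 'c, ('a \<times> 'c) \<times> ('a \<times> 'c)) pre_digraph" where
  "list_cover D L =
     (\<lambda>v. {v} \<times> L v,
      with_proj \<lparr>pverts = (SIGMA v : verts D. L v),
                 parcs = {((u, c), (v, c')) | u c v c'.
                    (u, v) \<in> arcs_ends D \<and> c \<in> L u \<and> c' \<in> L v \<and> c = c'}\<rparr>)"

definition partial_transversal ::
    "('a, 'b) pre_digraph \<Rightarrow> ('a \<Rightarrow> 'h set) \<Rightarrow> ('h, 'k) pre_digraph \<Rightarrow> 'h set \<Rightarrow> bool" where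
  "partial_transversal D X H T \<longleftrightarrow> T \<subseteq> verts H \<and> (\<forall>v \<in> verts D. card (T \<inter> X v) \<le> 1)"

definition transversal ::
    "('a, 'b) pre_digraph \<Rightarrow> ('a \<Rightarrow> 'h set) \<Rightarrow> ('h, 'k) pre_digraph \<Rightarrow> 'h set \<Rightarrow> bool" where
  "transversal D X H T \<longleftrightarrow> T \<subseteq> verts H \<and> (\<forall>v \<in> verts D. card (T \<inter> X v) = 1)"

definition dom_of :: "('a, 'b) pre_digraph \<Rightarrow> ('a \<Rightarrow> 'h set) \<Rightarrow> 'h set \<Rightarrow> 'a set" where
  "dom_of D X T = {v \<in> verts D. X v \<inter> T \<noteq> {}}"

definition property_transversal ::
    "digraph_property \<Rightarrow> ('a, 'b) pre_digraph \<Rightarrow> ('a \<Rightarrow> 'h set) \<Rightarrow> ('h, 'k) pre_digraph \<Rightarrow>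
     'h set \<Rightarrow> bool" where
  "property_transversal P D X H T \<longleftrightarrow> transversal D X H T \<and> has_property P (H \<restriction> T)"

definition property_transversal_avoiding ::
    "digraph_property \<Rightarrow> ('a, 'b) pre_digraph \<Rightarrow> ('a \<Rightarrow> 'h set) \<Rightarrow> ('h, 'k) pre_digraph \<Rightarrow>
     'a \<Rightarrow> 'h set \<Rightarrow> bool" where
  "property_transversal_avoiding P D X H v T \<longleftrightarrow>
     partial_transversal D X H T \<and> dom_of D X T = verts D - {v} \<and> has_property P (H \<restriction> T)"

definition critical_cover ::
    "digraph_property \<Rightarrow> ('a, 'b) pre_digraph \<Rightarrow> ('a \<Rightarrow> 'h set) \<Rightarrow> ('h, 'k) pre_digraph \<Rightarrow> bool"
    where
  "critical_cover P D X H \<longleftrightarrow> is_cover D X H \<and>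
     (\<nexists>T. property_transversal P D X H T) \<and>
     (\<forall>v \<in> verts D. \<exists>T. property_transversal_avoiding P D X H v T)"

definition low_vertices ::
    "digraph_property \<Rightarrow> ('a, 'b) pre_digraph \<Rightarrow> ('a \<Rightarrow> 'h set) \<Rightarrow> 'a set" where
  "low_vertices P D X =
     {v \<in> verts D. deg D v = (d_out P * card (X v), d_in P * card (X v))}"

definition low_vertex_subdigraph ::
    "digraph_property \<Rightarrow> ('a, 'b) pre_digraph \<Rightarrow> ('a \<Rightarrow> 'h set) \<Rightarrow> ('a, 'b) pre_digraph" where
  "low_vertex_subdigraph P D X = D \<restriction> low_vertices P D X"


section \<open>Dibricks\<close>

text \<open>The digraph obtained from the undirected graph \<open>(V, E)\<close> by replacing each edge by a digon.\<close>

definition bidirection :: "'a set \<Rightarrow> 'a set set \<Rightarrow> 'a pair_pre_digraph" where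
  "bidirection V E = \<lparr>pverts = V, parcs = {(u, v). u \<noteq> v \<and> {u, v} \<in> E}\<rparr>"

definition bidirected_complete :: "nat \<Rightarrow> nat pair_pre_digraph" where
  "bidirected_complete n = bidirection {..<n} {{i, j} | i j. i < n \<and> j < n \<and> i \<noteq> j}"

text \<open>This is the intended digraph for \<open>n \<ge> 3\<close> only.\<close>

definition bidirected_cycle :: "nat \<Rightarrow> nat pair_pre_digraph" where
  "bidirected_cycle n = bidirection {..<n} {{i, Suc i mod n} | i. i < n}"

definition dibrick :: "digraph_property \<Rightarrow> ('a, 'b) pre_digraph \<Rightarrow> bool" where
  "dibrick P B \<longleftrightarrow> digraph B \<and> connected B \<and>
     ((\<exists>n \<ge> 1. digraph_iso B (with_proj (bidirected_complete n))) \<or>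
      (\<exists>n \<ge> 3. odd n \<and> digraph_iso B (with_proj (bidirected_cycle n))) \<or>
      (has_property P B \<and> max_out_degree B \<le> d_out P \<and> max_in_degree B \<le> d_in P) \<or>
      (CR P B \<and> eulerian B \<and> d_out P = d_in P \<and>
         (\<forall>v \<in> verts B. out_degree B v = d_out P \<and> in_degree B v = d_in P)))"

end

theory Submission
  imports Defs "HOL-Library.Multiset" "HOL-Number_Theory.Cong"
begin

text \<open>
  Fix a colouring of \<open>D - v\<close> from the lists whose colour classes span a member of the property. Giving
  a low vertex \<open>v\<close> any colour \<open>c\<close> of its list creates a critical subdigraph through \<open>v\<close>, so \<open>v\<close> has
  at least \<open>d\<^sup>+\<close> out-neighbours and \<open>d\<^sup>-\<close> in-neighbours of colour \<open>c\<close>; by the degree condition these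
  are equalities and no other colour occurs around \<open>v\<close>. Hence every critical subdigraph contains all
  neighbours of \<open>v\<close> coloured \<open>c\<close>, and moving the colour of a neighbour \<open>u\<close> to \<open>v\<close> yields such a
  colouring of \<open>D - u\<close>: the uncoloured vertex is a hole that can be slid along arcs, while the
  multisets of colours around a given position of the hole never change.

  Slide the hole inside a block. Going once around a cycle rotates the colours on it. If the
  block is never coloured by more than one colour, its degrees are at most \<open>d\<close>, and if it is not in the
  property, a critical subdigraph of it must be the whole block. Otherwise some hole has two neighbours
  of different colours; a shortest path joining two such neighbours closes up to an induced
  cycle, which invariance under rotation forces to be bidirected of odd length. A triangle extends to a
  maximal bidirected clique. If the clique, or the longer cycle, is not the whole block, then a
  shortest ear attached to it gives a cycle around which the invariance fails.
\<close>

section \<open>Sliding a hole through a coloured digraph\<close>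

text \<open>While a vertex occurs twice, the piece between its two occurrences can be cut out, which
  shortens the walk and keeps both ends.\<close>

lemma walk_contains_path:
  assumes "successively P us" "us \<noteq> []"
  shows "\<exists>vs. vs \<noteq> [] \<and> hd vs = hd us \<and> last vs = last us \<and> set vs \<subseteq> set us \<and> distinct vs \<and>
    successively P vs"
  using assms
proof (induction "length us" arbitrary: us rule: less_induct)
  case less
  show ?case
  proof (cases "distinct us")
    case False
    then obtain xs ys zs y where us: "us = xs @ [y] @ ys @ [y] @ zs"
      using not_distinct_decomp by blast
    let ?ws = "xs @ [y] @ zs"
    have "successively P ?ws"
      using less.prems us by (auto simp: successively_append_iff successively_Cons)
    moreover have "length ?ws < length us" "?ws \<noteq> []" using us by auto
    ultimately obtain vs where vs: "vs \<noteq> []" "hd vs = hd ?ws" "last vs = last ?ws"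
        "set vs \<subseteq> set ?ws" "distinct vs" "successively P vs"
      using less.hyps by blast
    have "hd ?ws = hd us" "last ?ws = last us" "set ?ws \<subseteq> set us"
      using us by (auto simp: hd_append)
    then show ?thesis using vs by (metis subset_trans)
  qed (use less.prems in blast)
qed

lemma cong_Suc_iff:
  fixes i j k :: nat
  assumes "i < k" "j < k"
  shows "[j = Suc i] (mod k) \<longleftrightarrow> j = Suc i \<or> j = 0 \<and> Suc i = k"
proof (cases "Suc i = k")
  case True
  then show ?thesis using assms by (auto simp: cong_def)
next
  case False
  then show ?thesis using assms by (auto simp: cong_def)
qed

text \<open>
  \<open>S v \<phi>\<close> says that \<open>\<phi>\<close> is an admissible colouring of \<open>V - {v}\<close>; the value of \<open>\<phi>\<close> at the hole \<open>v\<close>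
  is junk.
\<close>

locale sliding =
  fixes V :: "'a set" and A :: "('a \<times> 'a) set" and S :: "'a \<Rightarrow> ('a \<Rightarrow> 'c) \<Rightarrow> bool"
  assumes finite_V: "finite V"
    and A_in_V: "A \<subseteq> V \<times> V"
    and irrefl_A: "(u, u) \<notin> A"
    and path_avoiding: "x \<in> V \<Longrightarrow> y \<in> V \<Longrightarrow> Z = {} \<or> Z = {z} \<Longrightarrow> x \<notin> Z \<Longrightarrow> y \<notin> Z \<Longrightarrow>
      \<exists>us. us \<noteq> [] \<and> hd us = x \<and> last us = y \<and> set us \<subseteq> V - Z \<and>
        successively (\<lambda>u v. (u, v) \<in> A \<or> (v, u) \<in> A) us"
    and hole_in_V: "S v \<phi> \<Longrightarrow> v \<in> V"
    and slide: "S v \<phi> \<Longrightarrow> (u, v) \<in> A \<or> (v, u) \<in> A \<Longrightarrow> S u (\<phi>(v := \<phi> u))"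
    and colours_at_hole: "S v \<phi> \<Longrightarrow> S v \<psi> \<Longrightarrow> R = A \<or> R = A\<inverse> \<Longrightarrow>
      image_mset \<phi> (mset_set (R `` {v})) = image_mset \<psi> (mset_set (R `` {v}))"
begin

definition adj :: "'a \<Rightarrow> 'a \<Rightarrow> bool" where
  "adj u v \<longleftrightarrow> (u, v) \<in> A \<or> (v, u) \<in> A"

lemma adj_sym: "adj u v \<longleftrightarrow> adj v u" and adj_irrefl: "\<not> adj u u"
  using irrefl_A by (auto simp: adj_def)

lemma adj_sym_fun: "(\<lambda>u v. adj v u) = adj"
  by (auto simp: adj_def fun_eq_iff)

lemma adj_in_V: "adj u v \<Longrightarrow> u \<in> V" "adj u v \<Longrightarrow> v \<in> V"
  using A_in_V by (auto simp: adj_def)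

lemma path_between:
  assumes "x \<in> V" "y \<in> V" "Z = {} \<or> Z = {z}" "x \<notin> Z" "y \<notin> Z"
  obtains us where "us \<noteq> []" "hd us = x" "last us = y" "set us \<subseteq> V - Z" "distinct us"
    "successively adj us"
proof -
  have "(\<lambda>u v. (u, v) \<in> A \<or> (v, u) \<in> A) = adj" by (simp add: adj_def fun_eq_iff)
  then obtain us where us: "us \<noteq> []" "hd us = x" "last us = y" "set us \<subseteq> V - Z" "successively adj us"
    using path_avoiding[OF assms] by (elim exE) (simp only:, blast)
  with walk_contains_path[of adj us] that show thesis by (metis subset_trans)
qed

section \<open>Moving the hole along paths and around cycles\<close>

lemma slide_adj: "S v \<phi> \<Longrightarrow> adj v u \<Longrightarrow> S u (\<phi>(v := \<phi> u))"
  using slide by (auto simp: adj_def)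

text \<open>Neighbours outside \<open>U\<close> have the same colour in both colourings and cancel
  from \<open>colours_at_hole\<close>. The set \<open>U\<close> will consist of the few vertices
  recoloured by a rotation or a swap.\<close>

lemma colours_at_hole_local:
  assumes "S v \<phi>" "S v \<psi>" "R = A \<or> R = A\<inverse>"
    and eq: "\<And>w. w \<in> V \<Longrightarrow> w \<notin> U \<Longrightarrow> w \<noteq> v \<Longrightarrow> \<phi> w = \<psi> w"
  shows "image_mset \<phi> (mset_set (R `` {v} \<inter> U)) = image_mset \<psi> (mset_set (R `` {v} \<inter> U))"
proof -
  let ?N = "R `` {v}"
  have N: "?N \<subseteq> V" "v \<notin> ?N" using A_in_V irrefl_A assms(3) by auto
  then have fin: "finite ?N" using finite_V finite_subset by blast
  have "mset_set ?N = mset_set (?N \<inter> U) + mset_set (?N - U)"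
    using fin by (subst mset_set_Union[symmetric]) (auto simp: Int_Diff_Un)
  moreover have "image_mset \<phi> (mset_set (?N - U)) = image_mset \<psi> (mset_set (?N - U))"
    using N fin by (intro image_mset_cong) (auto intro!: eq)
  ultimately show ?thesis using colours_at_hole[OF assms(1-3)] by simp
qed

text \<open>Each slide copies the colour of the next vertex onto the vertex being left, so the
  colours move one place back along the path. \<open>butlast\<close> omits the final hole, whose
  value is junk.\<close>

lemma slide_path:
  assumes "S v \<phi>" "successively adj (v # us)" "distinct (v # us)"
  shows "\<exists>\<psi>. S (last (v # us)) \<psi> \<and> map \<psi> (butlast (v # us)) = map \<phi> us \<and>
    (\<forall>w. w \<notin> set (v # us) \<longrightarrow> \<psi> w = \<phi> w)"
  using assms
proof (induction us arbitrary: v \<phi>)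
  case (Cons u us)
  have "S u (\<phi>(v := \<phi> u))" using Cons.prems slide_adj by (auto simp: successively_Cons)
  moreover have "successively adj (u # us)" "distinct (u # us)"
    using Cons.prems by (auto simp: successively_Cons)
  ultimately obtain \<psi> where \<psi>: "S (last (u # us)) \<psi>"
      "map \<psi> (butlast (u # us)) = map (\<phi>(v := \<phi> u)) us"
      "\<forall>w. w \<notin> set (u # us) \<longrightarrow> \<psi> w = (\<phi>(v := \<phi> u)) w"
    using Cons.IH by blast
  \<comment> \<open>The path never returns to \<open>v\<close>, so the later slides keep the colour
    placed there.\<close>
  have "\<psi> v = \<phi> u" using \<psi>(3) Cons.prems by auto
  moreover have "map (\<phi>(v := \<phi> u)) us = map \<phi> us" using Cons.prems by auto
  ultimately show ?case using \<psi> by (intro exI[of _ \<psi>]) auto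
qed auto

definition cycle_at :: "'a \<Rightarrow> 'a list \<Rightarrow> bool" where
  "cycle_at v us \<longleftrightarrow> us \<noteq> [] \<and> distinct (v # us) \<and> successively adj (v # us) \<and> adj (last us) v"

lemma rotate_cycle:
  assumes "S v \<phi>" "cycle_at v us"
  obtains \<psi> where "S v \<psi>" "map \<psi> us = rotate1 (map \<phi> us)"
    "\<And>w. w \<notin> set us \<Longrightarrow> w \<noteq> v \<Longrightarrow> \<psi> w = \<phi> w"
proof -
  have us: "us \<noteq> []" "distinct (v # us)" "successively adj (v # us)" "adj (last us) v"
    using assms(2) by (auto simp: cycle_at_def)
  obtain \<chi> where \<chi>: "S (last us) \<chi>" "map \<chi> (butlast (v # us)) = map \<phi> us"
      "\<And>w. w \<notin> set (v # us) \<Longrightarrow> \<chi> w = \<phi> w"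
    using slide_path[OF assms(1) us(3,2)] us(1) by auto
  obtain u us' where u: "us = u # us'" using us(1) by (cases us) auto
  \<comment> \<open>The closing slide. The tour has parked the colour of \<open>hd us\<close> at
    \<open>v\<close>; it now comes to rest at \<open>last us\<close>.\<close>
  define \<psi> where "\<psi> = \<chi>(last us := \<chi> v)"
  have "S v \<psi>" using slide_adj[OF \<chi>(1) us(4)] by (simp add: \<psi>_def)
  moreover
  have bl: "\<chi> v = \<phi> u" "map \<chi> (butlast us) = map \<phi> us'"
    using \<chi>(2) u by auto
  have "last us \<notin> set (butlast us)"
    using us(1,2) by (metis append_butlast_last_id distinct.simps(2) distinct_butlast not_distinct_conv_prefix)
  then have "map \<psi> (butlast us @ [last us]) = map \<phi> us' @ [\<phi> u]"
    using bl by (simp add: \<psi>_def)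
  then have "map \<psi> us = rotate1 (map \<phi> us)"
    unfolding append_butlast_last_id[OF us(1)] using u by simp
  moreover have "\<psi> w = \<phi> w" if "w \<notin> set us" "w \<noteq> v" for w
    using that \<chi>(3) us(1) by (auto simp: \<psi>_def)
  ultimately show thesis using that by blast
qed

text \<open>A rotation replaces the colours of \<open>hd us\<close> and \<open>last us\<close> by
  those of \<open>us ! 1\<close> and \<open>hd us\<close>. In each direction the colours seen from
  the hole must form the same multiset before and after; the cases of which of the two arcs the
  direction contains give both claims.\<close>

lemma two_neighbours_on_cycle:
  assumes "S v \<phi>" and cyc: "cycle_at v us" and len: "2 \<le> length us"
    and two: "\<And>w. w \<in> set us \<Longrightarrow> adj v w \<Longrightarrow> w = hd us \<or> w = last us"
  shows "\<phi> (us ! 1) = \<phi> (last us)"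
    and "\<phi> (hd us) \<noteq> \<phi> (last us) \<Longrightarrow> R = A \<or> R = A\<inverse> \<Longrightarrow> (v, hd us) \<in> R \<longleftrightarrow> (v, last us) \<in> R"
proof -
  obtain \<psi> where \<psi>: "S v \<psi>" "map \<psi> us = rotate1 (map \<phi> us)"
      "\<And>w. w \<notin> set us \<Longrightarrow> w \<noteq> v \<Longrightarrow> \<psi> w = \<phi> w"
    using rotate_cycle[OF assms(1,2)] by blast
  have us: "us \<noteq> []" "distinct us" "adj v (hd us)" "adj v (last us)"
    using cyc adj_sym by (auto simp: cycle_at_def successively_Cons)
  obtain x y zs where xy: "us = x # y # zs"
    using len by (cases us; cases "tl us") auto
  have "\<psi> (last us) = last (map \<psi> us)" using us(1) by (simp add: last_map)
  also have "\<dots> = \<phi> (hd us)" by (simp only: \<psi>(2)) (simp add: xy)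
  finally have nth: "\<psi> (hd us) = \<phi> (us ! 1)" "\<psi> (last us) = \<phi> (hd us)"
    using \<psi>(2) by (auto simp: xy)
  have ne: "hd us \<noteq> last us" using us xy by auto
  have mseq: "image_mset \<phi> (mset_set (R `` {v} \<inter> set us)) = image_mset \<psi> (mset_set (R `` {v} \<inter> set us))"
    if "R = A \<or> R = A\<inverse>" for R
    using colours_at_hole_local[OF assms(1) \<psi>(1) that] \<psi>(3) by metis
  have sub: "R `` {v} \<inter> set us = {w. (w = hd us \<or> w = last us) \<and> (v, w) \<in> R}" if "R = A \<or> R = A\<inverse>" for R
    using that two us(1) by (auto simp: adj_def)
  have both: "\<phi> (us ! 1) = \<phi> (last us)"
    if R: "R = A \<or> R = A\<inverse>" and "(v, hd us) \<in> R" "(v, last us) \<in> R" for R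
  proof -
    have "R `` {v} \<inter> set us = {hd us, last us}" using sub[OF R] that by auto
    then show ?thesis using mseq[OF R] ne nth by (auto simp: add_eq_conv_ex)
  qed
  have only_hd: "\<phi> (hd us) = \<phi> (us ! 1)"
    if R: "R = A \<or> R = A\<inverse>" and "(v, hd us) \<in> R" "(v, last us) \<notin> R" for R
  proof -
    have "R `` {v} \<inter> set us = {hd us}" using sub[OF R] that by auto
    then show ?thesis using mseq[OF R] ne nth by auto
  qed
  have only_last: "\<phi> (hd us) = \<phi> (last us)"
    if R: "R = A \<or> R = A\<inverse>" and "(v, hd us) \<notin> R" "(v, last us) \<in> R" for R
  proof -
    have "R `` {v} \<inter> set us = {last us}" using sub[OF R] that by auto
    then show ?thesis using mseq[OF R] ne nth by auto
  qed
  have ends: "(v, hd us) \<in> A \<or> (v, hd us) \<in> A\<inverse>" "(v, last us) \<in> A \<or> (v, last us) \<in> A\<inverse>"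
    using us(3,4) by (auto simp: adj_def)
  \<comment> \<open>If no direction contains both arcs, then one contains only the arc for
    \<open>hd us\<close> and the other only that for \<open>last us\<close>, and the two resulting
    equations combine.\<close>
  show eq: "\<phi> (us ! 1) = \<phi> (last us)"
    using ends both only_hd only_last by metis
  show "(v, hd us) \<in> R \<longleftrightarrow> (v, last us) \<in> R" if "\<phi> (hd us) \<noteq> \<phi> (last us)" "R = A \<or> R = A\<inverse>"
    using that eq only_hd only_last by metis
qed

text \<open>On a triangle through the hole a rotation moves just two colours, so it exchanges
  them.\<close>

lemma swap_triangle:
  assumes "S v \<phi>" "adj v x" "adj x y" "adj y v"
  obtains \<psi> where "S v \<psi>" "\<psi> x = \<phi> y" "\<psi> y = \<phi> x"
    "\<And>w. w \<noteq> x \<Longrightarrow> w \<noteq> y \<Longrightarrow> w \<noteq> v \<Longrightarrow> \<psi> w = \<phi> w"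
proof -
  have "cycle_at v [x, y]" using assms adj_irrefl by (auto simp: cycle_at_def)
  then obtain \<psi> where "S v \<psi>" "map \<psi> [x, y] = rotate1 (map \<phi> [x, y])"
      "\<And>w. w \<notin> set [x, y] \<Longrightarrow> w \<noteq> v \<Longrightarrow> \<psi> w = \<phi> w"
    using rotate_cycle[OF assms(1)] by blast
  then show thesis using that by auto
qed

text \<open>Suppose that in every admissible colouring the neighbours of the hole had a single
  colour. Sliding the hole along a path then shows that each vertex has the colour of some neighbour
  of \<open>v\<close>, so all vertices other than \<open>v\<close> agree.\<close>

lemma differently_coloured_neighbours:
  assumes "S v \<phi>" "x \<in> V" "y \<in> V" "x \<noteq> v" "y \<noteq> v" "\<phi> x \<noteq> \<phi> y"
  shows "\<exists>v \<phi> x y. S v \<phi> \<and> adj v x \<and> adj v y \<and> \<phi> x \<noteq> \<phi> y"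
proof (rule ccontr)
  assume prem: "\<not> ?thesis"
  then have mono: "\<phi> x = \<phi> y" if "S v \<phi>" "adj v x" "adj v y" for v \<phi> x y
    using that prem by blast
  \<comment> \<open>Only the last vertex must not be met earlier; this is what lets it keep its
    colour under the slides.\<close>
  have key: "\<phi> (hd us) = \<phi> (last us)"
    if "S v \<phi>" "us \<noteq> []" "successively adj (v # us)" "last us \<notin> set (v # butlast us)" for v \<phi> us
    using that
  proof (induction us arbitrary: v \<phi>)
    case (Cons u us)
    show ?case
    proof (cases "us = []")
      case False
      let ?\<psi> = "\<phi>(v := \<phi> u)"
      have u: "S u ?\<psi>" using Cons.prems slide_adj by (auto simp: successively_Cons)
      have "?\<psi> (hd us) = ?\<psi> (last us)"
        using Cons.IH[OF u False] Cons.prems False by (auto simp: successively_Cons)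
      \<comment> \<open>Both \<open>v\<close> and \<open>hd us\<close> are neighbours of the new
        hole \<open>u\<close>, and \<open>v\<close> now carries the old colour of
        \<open>u\<close>.\<close>
      moreover have "?\<psi> v = ?\<psi> (hd us)"
        using mono[OF u, of v "hd us"] Cons.prems False by (auto simp: successively_Cons adj_sym[of u v])
      ultimately show ?thesis using Cons.prems False by auto
    qed simp
  qed auto
  have *: "\<exists>u. adj v u \<and> \<phi> u = \<phi> w" if w: "w \<in> V" "w \<noteq> v" for w
  proof -
    obtain us where us: "us \<noteq> []" "hd us = v" "last us = w" "distinct us" "successively adj us"
      using path_between[of v w "{}"] w hole_in_V[OF assms(1)] by blast
    then obtain us' where us': "us = v # us'" "us' \<noteq> []"
      using w(2) us(1-3) by (metis last_ConsL list.exhaust_sel)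
    have "last us' \<notin> set (butlast us')"
      using us(4) us' by (metis append_butlast_last_id distinct.simps(2) distinct_butlast not_distinct_conv_prefix)
    then have "\<phi> (hd us') = \<phi> w"
      using key[OF assms(1) us'(2)] us us' w by auto
    moreover have "adj v (hd us')" using us us' by (auto simp: successively_Cons)
    ultimately show ?thesis by blast
  qed
  from *[of x] *[of y] assms mono[OF assms(1)] show False by metis
qed

section \<open>Induced cycles and the repetition of colours on them\<close>

definition induced_cycle :: "'a list \<Rightarrow> bool" where
  "induced_cycle c \<longleftrightarrow> distinct c \<and> 3 \<le> length c \<and> set c \<subseteq> V \<and>
    (\<forall>i < length c. \<forall>j < length c. adj (c ! i) (c ! j) \<longleftrightarrow>
      [j = Suc i] (mod length c) \<or> [i = Suc j] (mod length c))"

text \<open>Rotation adds \<open>m\<close> to both indices modulo the length, which leaves the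
  congruences of the definition intact; this is why adjacency is described there by congruences and
  not by listing the wrap-around cases.\<close>

lemma induced_cycle_rotate:
  assumes "induced_cycle c"
  shows "induced_cycle (rotate m c)"
proof -
  let ?k = "length c"
  have "adj (rotate m c ! i) (rotate m c ! j) \<longleftrightarrow> [j = Suc i] (mod ?k) \<or> [i = Suc j] (mod ?k)"
    if ij: "i < ?k" "j < ?k" for i j
  proof -
    have "0 < ?k" using ij by linarith
    then have "adj (rotate m c ! i) (rotate m c ! j) \<longleftrightarrow>
      [(m + j) mod ?k = Suc ((m + i) mod ?k)] (mod ?k) \<or> [(m + i) mod ?k = Suc ((m + j) mod ?k)] (mod ?k)"
      using assms ij by (simp add: induced_cycle_def nth_rotate)
    also have "\<dots> \<longleftrightarrow> [m + j = m + Suc i] (mod ?k) \<or> [m + i = m + Suc j] (mod ?k)"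
      by (simp add: cong_def mod_Suc_eq)
    finally show ?thesis by (simp only: cong_add_lcancel_nat)
  qed
  then show ?thesis using assms by (simp add: induced_cycle_def)
qed

lemma induced_cycle_adj_iff:
  assumes "induced_cycle c" "i < length c" "j < length c"
  shows "adj (c ! i) (c ! j) \<longleftrightarrow>
    j = Suc i \<or> i = Suc j \<or> j = 0 \<and> Suc i = length c \<or> i = 0 \<and> Suc j = length c"
  using assms cong_Suc_iff[of i "length c" j] cong_Suc_iff[of j "length c" i]
  by (auto simp: induced_cycle_def)

text \<open>Supplies the premises of \<open>two_neighbours_on_cycle\<close> for a hole placed on an
  induced cycle.\<close>

lemma induced_cycle_at:
  assumes "induced_cycle (v # us)"
  shows "cycle_at v us" "w \<in> set us \<Longrightarrow> adj v w \<Longrightarrow> w = hd us \<or> w = last us"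
    "2 \<le> length us"
proof -
  have len: "2 \<le> length us" "distinct (v # us)" using assms by (auto simp: induced_cycle_def)
  have "successively adj (v # us)"
    unfolding successively_conv_nth
  proof (intro allI impI)
    fix i assume "Suc i < length (v # us)"
    then show "adj ((v # us) ! i) ((v # us) ! Suc i)"
      using induced_cycle_adj_iff[OF assms, of i "Suc i"] by simp
  qed
  moreover have "adj (last us) v"
    using induced_cycle_adj_iff[OF assms, of "length us" 0] len
    by (cases us rule: rev_cases) (auto simp: nth_append)
  ultimately show "cycle_at v us" using len by (auto simp: cycle_at_def)
  show "w = hd us \<or> w = last us" if w: "w \<in> set us" "adj v w"
  proof -
    obtain i where i: "i < length us" "us ! i = w" using w(1) by (auto simp: in_set_conv_nth)
    then have "i = 0 \<or> Suc i = length us"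
      using induced_cycle_adj_iff[OF assms, of 0 "Suc i"] w by auto
    then show ?thesis using i by (metis diff_Suc_1 hd_conv_nth last_conv_nth list.size(3) not_less_zero)
  qed
  show "2 \<le> length us" by (rule len)
qed

text \<open>After \<open>i + 1\<close> rotations the colours of \<open>us ! (i + 2)\<close> and
  \<open>us ! i\<close> stand at \<open>us ! 1\<close> and \<open>last us\<close>, where
  \<open>two_neighbours_on_cycle\<close> makes them equal.\<close>

lemma induced_cycle_colours:
  assumes cyc: "induced_cycle (v # us)" and "S v \<phi>" and "i + 2 < length us"
  shows "\<phi> (us ! i) = \<phi> (us ! (i + 2))"
proof -
  have "\<exists>\<psi>. S v \<psi> \<and> map \<psi> us = rotate m (map \<phi> us)" for m
  proof (induction m)
    case (Suc m)
    then obtain \<psi> where \<psi>: "S v \<psi>" "map \<psi> us = rotate m (map \<phi> us)" by blast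
    from rotate_cycle[OF \<psi>(1) induced_cycle_at(1)[OF cyc]] \<psi>(2) show ?case by (metis rotate_Suc)
  qed (use assms in auto)
  then obtain \<psi> where \<psi>: "S v \<psi>" "map \<psi> us = rotate (i + 1) (map \<phi> us)" by blast
  let ?n = "length us"
  have pos: "us \<noteq> []" using assms(3) by auto
  have nth: "\<psi> (us ! j) = \<phi> (us ! ((i + 1 + j) mod ?n))" if "j < ?n" for j
    using arg_cong[OF \<psi>(2), of "\<lambda>xs. xs ! j"] that pos
    by (simp add: nth_rotate del: rotate_Suc)
  have "\<psi> (us ! 1) = \<psi> (last us)"
    using two_neighbours_on_cycle(1)[OF \<psi>(1) induced_cycle_at(1)[OF cyc] induced_cycle_at(3)[OF cyc]]
      induced_cycle_at(2)[OF cyc] by blast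
  moreover have "last us = us ! (?n - 1)" using assms(3) by (intro last_conv_nth) auto
  moreover have "i + 1 + (?n - 1) = i + ?n" using assms(3) by linarith
  then have "(i + 1 + (?n - 1)) mod ?n = i" using assms(3) by simp
  ultimately show ?thesis using nth[of 1] nth[of "?n - 1"] assms(3) by (simp add: numeral_2_eq_2)
qed

section \<open>Induced cycles with two colours next to the hole\<close>

definition bad_cycle :: "'a list \<Rightarrow> ('a \<Rightarrow> 'c) \<Rightarrow> bool" where
  "bad_cycle c \<phi> \<longleftrightarrow> induced_cycle c \<and> S (hd c) \<phi> \<and> \<phi> (c ! 1) \<noteq> \<phi> (last c)"

text \<open>Steps of two keep the colour, and \<open>us ! 1\<close> has the colour of
  \<open>last us\<close>; hence two colours alternate along \<open>us\<close>.\<close>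

lemma bad_cycle_colours:
  assumes "bad_cycle (v # us) \<phi>" "i < length us"
  shows "\<phi> (us ! i) = (if even i then \<phi> (hd us) else \<phi> (last us))"
proof -
  have cyc: "induced_cycle (v # us)" "S v \<phi>" "\<phi> (hd us) \<noteq> \<phi> (last us)"
    using assms(1) by (auto simp: bad_cycle_def induced_cycle_def hd_conv_nth split: if_splits)
  have "\<phi> (us ! 1) = \<phi> (last us)"
    using two_neighbours_on_cycle(1)[OF cyc(2) induced_cycle_at(1)[OF cyc(1)] induced_cycle_at(3)[OF cyc(1)]]
      induced_cycle_at(2)[OF cyc(1)] by blast
  moreover have "\<phi> (us ! 0) = \<phi> (hd us)" using assms(2) by (cases us) auto
  moreover have "\<phi> (us ! i) = (if even i then \<phi> (us ! 0) else \<phi> (us ! 1))"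
    using assms(2)
  proof (induction i rule: less_induct)
    case (less i)
    show ?case
    proof (cases "i < 2")
      case True
      then show ?thesis by (auto simp: less_2_cases_iff)
    next
      case False
      then obtain j where "i = j + 2" by (metis add.commute le_Suc_ex linorder_not_less)
      then show ?thesis using less.IH[of j] less.prems induced_cycle_colours[OF cyc(1,2), of j] by simp
    qed
  qed
  ultimately show ?thesis by simp
qed

lemma bad_cycle_hd_last: "bad_cycle (v # us) \<phi> \<Longrightarrow> \<phi> (hd us) \<noteq> \<phi> (last us)"
  by (auto simp: bad_cycle_def induced_cycle_def hd_conv_nth split: if_splits)

text \<open>The alternation begins with the colour of \<open>hd us\<close> and ends with the other
  one, so \<open>us\<close> has even length; the hole adds one.\<close>

lemma bad_cycle_odd:
  assumes "bad_cycle c \<phi>"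
  shows "odd (length c)"
proof -
  obtain v us where c: "c = v # us" "us \<noteq> []"
    using assms by (cases c; cases "tl c") (auto simp: bad_cycle_def induced_cycle_def)
  have "\<phi> (last us) = \<phi> (us ! (length us - 1))" using c by (simp add: last_conv_nth)
  then have "odd (length us - 1)"
    using bad_cycle_colours[of v us \<phi> "length us - 1"] bad_cycle_hd_last[of v us \<phi>] assms c
    by (auto split: if_splits)
  then show ?thesis using c by auto
qed

text \<open>The hole moves to the next vertex \<open>x\<close>. Its neighbours on the cycle are now
  \<open>y\<close> and \<open>v\<close>, and \<open>v\<close> has taken the colour of
  \<open>x\<close>, which by alternation differs from that of \<open>y\<close>.\<close>

lemma bad_cycle_rotate1:
  assumes "bad_cycle c \<phi>"
  shows "\<exists>\<psi>. bad_cycle (rotate1 c) \<psi> \<and> (\<forall>w. w \<notin> set c \<longrightarrow> \<psi> w = \<phi> w)"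
proof -
  obtain v x y zs where c: "c = v # x # y # zs"
    using assms by (cases c; cases "tl c"; cases "tl (tl c)") (auto simp: bad_cycle_def induced_cycle_def)
  have d: "induced_cycle c" "S v \<phi>" "distinct c" using assms c by (auto simp: bad_cycle_def induced_cycle_def)
  let ?\<psi> = "\<phi>(v := \<phi> x)"
  have "adj v x" using induced_cycle_adj_iff[OF d(1), of 0 1] c by simp
  then have "S x ?\<psi>" using slide_adj[OF d(2)] by blast
  moreover have "\<phi> y \<noteq> \<phi> x"
    using bad_cycle_colours[of v "x # y # zs" \<phi> 1] bad_cycle_hd_last[of v "x # y # zs" \<phi>] assms c by simp
  moreover have "induced_cycle (rotate1 c)" using induced_cycle_rotate[OF d(1), of 1] by simp
  ultimately have "bad_cycle (rotate1 c) ?\<psi>" using c d(3) by (auto simp: bad_cycle_def)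
  then show ?thesis using c by auto
qed

lemma bad_cycle_rotate:
  assumes "bad_cycle c \<phi>"
  shows "\<exists>\<psi>. bad_cycle (rotate m c) \<psi> \<and> (\<forall>w. w \<notin> set c \<longrightarrow> \<psi> w = \<phi> w)"
proof (induction m)
  case (Suc m)
  then obtain \<psi> where "bad_cycle (rotate m c) \<psi>" "\<forall>w. w \<notin> set c \<longrightarrow> \<psi> w = \<phi> w" by blast
  with bad_cycle_rotate1[of "rotate m c" \<psi>] show ?case by auto
qed (use assms in auto)

text \<open>On alternating colours one rotation exchanges the two colours. Comparing both colourings
  will refute any constraint that links the cycle with a vertex off it.\<close>

lemma bad_cycle_swap:
  assumes "bad_cycle (v # us) \<phi>"
  obtains \<psi> where "bad_cycle (v # us) \<psi>" "\<psi> (hd us) = \<phi> (last us)" "\<psi> (last us) = \<phi> (hd us)"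
    "\<And>w. w \<notin> set (v # us) \<Longrightarrow> \<psi> w = \<phi> w"
proof -
  have cyc: "induced_cycle (v # us)" "S v \<phi>" using assms by (auto simp: bad_cycle_def)
  obtain \<psi> where \<psi>: "S v \<psi>" "map \<psi> us = rotate1 (map \<phi> us)"
      "\<And>w. w \<notin> set us \<Longrightarrow> w \<noteq> v \<Longrightarrow> \<psi> w = \<phi> w"
    using rotate_cycle[OF cyc(2) induced_cycle_at(1)[OF cyc(1)]] by blast
  obtain x y zs where us: "us = x # y # zs"
    using induced_cycle_at(3)[OF cyc(1)] by (cases us; cases "tl us") auto
  have ne: "us \<noteq> []" using us by simp
  have "\<psi> (last us) = last (map \<psi> us)" using ne by (simp add: last_map)
  also have "\<dots> = \<phi> (hd us)" by (simp only: \<psi>(2)) (simp add: us)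
  finally have l: "\<psi> (last us) = \<phi> (hd us)" .
  have "\<psi> (hd us) = \<phi> y" using \<psi>(2) by (simp add: us)
  also have "\<phi> y = \<phi> (last us)" using bad_cycle_colours[OF assms, of 1] us by simp
  finally have h: "\<psi> (hd us) = \<phi> (last us)" .
  have "us ! 0 = hd us" using us by simp
  then have "bad_cycle (v # us) \<psi>"
    using cyc \<psi>(1) h l bad_cycle_hd_last[OF assms] ne by (simp add: bad_cycle_def)
  then show thesis using that h l \<psi>(3) by auto
qed

text \<open>Different colours next to the hole force it to be joined to both cycle neighbours by
  arcs of the same directions, seen from the hole. Read along the cycle, the direction pattern of an
  edge therefore reverses at every step. Odd length brings the first edge back reversed, so every
  edge is a digon.\<close>

lemma bad_cycle_bidirected:
  assumes "bad_cycle c \<phi>" "i < length c" "j < length c"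
  shows "(c ! i, c ! j) \<in> A \<longleftrightarrow> [j = Suc i] (mod length c) \<or> [i = Suc j] (mod length c)"
proof -
  let ?k = "length c"
  \<comment> \<open>Indices modulo the length let the induction below run once around the cycle and
    past its start.\<close>
  define d where "d i = c ! (i mod ?k)" for i
  have k: "0 < ?k" using assms(2) by linarith
  \<comment> \<open>The hole is put at \<open>d (Suc i)\<close>, between \<open>d i\<close> and
    \<open>d (Suc (Suc i))\<close>.\<close>
  have step: "(d (Suc i), d (Suc (Suc i))) \<in> R \<longleftrightarrow> (d (Suc i), d i) \<in> R" if R: "R = A \<or> R = A\<inverse>" for i R
  proof -
    obtain \<psi> where \<psi>: "bad_cycle (rotate (Suc i) c) \<psi>" using bad_cycle_rotate[OF assms(1)] by blast
    obtain v us where vus: "rotate (Suc i) c = v # us" using k by (cases "rotate (Suc i) c") auto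
    have len: "?k = Suc (length us)" using arg_cong[OF vus, of length] by simp
    have cyc: "induced_cycle (v # us)" "S v \<psi>" using \<psi> vus by (auto simp: bad_cycle_def)
    have len2: "2 \<le> length us" using induced_cycle_at(3)[OF cyc(1)] .
    have nth: "(v # us) ! j = d (Suc i + j)" if "j < ?k" for j
      using nth_rotate[OF that, of "Suc i"] unfolding vus d_def by simp
    have "v = d (Suc i)" using nth[of 0] k by simp
    moreover have "hd us = d (Suc (Suc i))" using nth[of 1] len len2 by (cases us) auto
    moreover have "last us = d i"
    proof -
      have "last us = (v # us) ! length us" using len2 by (cases us rule: rev_cases) (auto simp: nth_append)
      also have "\<dots> = d (Suc i + length us)" using nth[of "length us"] len by simp
      also have "Suc i + length us = i + ?k" using len by simp
      also have "d (i + ?k) = d i" by (simp add: d_def)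
      finally show ?thesis .
    qed
    moreover have "(v, hd us) \<in> R \<longleftrightarrow> (v, last us) \<in> R"
    proof (rule two_neighbours_on_cycle(2)[OF cyc(2) induced_cycle_at(1)[OF cyc(1)] len2 _ _ R])
      show "\<psi> (hd us) \<noteq> \<psi> (last us)" using bad_cycle_hd_last \<psi> vus by simp
    qed (rule induced_cycle_at(2)[OF cyc(1)])
    ultimately show ?thesis by simp
  qed
  have alt: "((d j, d (Suc j)) \<in> A \<longleftrightarrow> (if even j then (d 0, d 1) \<in> A else (d 1, d 0) \<in> A)) \<and>
      ((d (Suc j), d j) \<in> A \<longleftrightarrow> (if even j then (d 1, d 0) \<in> A else (d 0, d 1) \<in> A))" for j
  proof (induction j)
    case (Suc j)
    then show ?case using step[of A j] step[of "A\<inverse>" j] by auto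
  qed simp
  \<comment> \<open>After \<open>?k\<close> steps, an odd number, the first edge is met again with
    its pattern reversed.\<close>
  have "d ?k = d 0" "d (Suc ?k) = d 1" by (simp_all add: d_def mod_Suc)
  moreover have "(d ?k, d (Suc ?k)) \<in> A \<longleftrightarrow> (d 1, d 0) \<in> A"
    unfolding conjunct1[OF alt[of ?k]] using bad_cycle_odd[OF assms(1)] by simp
  ultimately have eq: "(d 0, d 1) \<in> A \<longleftrightarrow> (d 1, d 0) \<in> A" by (simp only:)
  have ind: "induced_cycle c" using assms(1) by (simp add: bad_cycle_def)
  have "3 \<le> ?k" using ind by (simp add: induced_cycle_def)
  then have "d 0 = c ! 0" "d 1 = c ! 1" by (simp_all add: d_def)
  then have "adj (d 0) (d 1)" using induced_cycle_adj_iff[OF ind k, of 1] \<open>3 \<le> ?k\<close> by simp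
  then have all: "(d j, d (Suc j)) \<in> A" "(d (Suc j), d j) \<in> A" for j
    using alt[of j] eq by (auto simp: adj_def split: if_splits)
  show ?thesis
  proof
    assume "(c ! i, c ! j) \<in> A"
    then show "[j = Suc i] (mod ?k) \<or> [i = Suc j] (mod ?k)"
      using ind assms(2,3) by (auto simp: induced_cycle_def adj_def)
  next
    assume "[j = Suc i] (mod ?k) \<or> [i = Suc j] (mod ?k)"
    then have "j mod ?k = Suc i mod ?k \<or> i mod ?k = Suc j mod ?k" by (simp only: cong_def)
    then have "d j = d (Suc i) \<or> d i = d (Suc j)" unfolding d_def by metis
    then have "(d i, d j) \<in> A" using all[of i] all[of j] by auto
    then show "(c ! i, c ! j) \<in> A" using assms(2,3) by (simp add: d_def)
  qed
qed

text \<open>For a hole with differently coloured neighbours, two such neighbours are joined by a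
  shortest walk avoiding the hole; minimality excludes every chord of the cycle closed up by the
  hole.\<close>

lemma ex_bad_cycle:
  assumes "S v \<phi>" "x \<in> V" "y \<in> V" "x \<noteq> v" "y \<noteq> v" "\<phi> x \<noteq> \<phi> y"
  shows "\<exists>c \<phi>. bad_cycle c \<phi>"
proof -
  obtain v \<phi> x y where v: "S v \<phi>" "adj v x" "adj v y" "\<phi> x \<noteq> \<phi> y"
    using differently_coloured_neighbours[OF assms] by blast
  \<comment> \<open>The ends are left free, so minimality ranges over all differently coloured pairs
    of neighbours of \<open>v\<close>.\<close>
  define Q where "Q us \<longleftrightarrow> us \<noteq> [] \<and> set us \<subseteq> V - {v} \<and> successively adj us \<and> adj v (hd us) \<and>
    adj v (last us) \<and> \<phi> (hd us) \<noteq> \<phi> (last us)" for us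
  have "x \<in> V" "y \<in> V" "x \<notin> {v}" "y \<notin> {v}" using v adj_in_V adj_irrefl by auto
  then obtain us where "us \<noteq> []" "hd us = x" "last us = y" "set us \<subseteq> V - {v}" "successively adj us"
    using path_between[of x y "{v}" v] by blast
  then have "\<exists>us. Q us" using v unfolding Q_def by auto
  then obtain us where us: "Q us" and least: "\<And>ws. Q ws \<Longrightarrow> length us \<le> length ws"
    using ex_has_least_nat[of Q _ length] by blast
  let ?n = "length us"
  have us': "us \<noteq> []" "set us \<subseteq> V - {v}" "successively adj us" "adj v (hd us)"
    "adj v (last us)" "\<phi> (hd us) \<noteq> \<phi> (last us)" using us by (auto simp: Q_def)
  have take: "us = take i us @ drop i us" for i by simp
  have suc: "successively adj (take i us)" "successively adj (drop i us)" for i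
    using us'(3) take[of i] by (metis successively_append_iff)+
  have sub: "set (take i us) \<subseteq> V - {v}" "set (drop i us) \<subseteq> V - {v}" for i
    using us'(2) set_take_subset[of i us] set_drop_subset[of i us] by blast+
  have distinct: "distinct us"
  proof -
    obtain vs where "vs \<noteq> []" "hd vs = hd us" "last vs = last us" "set vs \<subseteq> set us" "distinct vs"
      "successively adj vs" using walk_contains_path[OF us'(3,1)] by blast
    moreover from this have "Q vs" using us' by (auto simp: Q_def)
    then have "length us \<le> length vs" by (rule least)
    moreover have "length vs \<le> card (set us)"
      using \<open>distinct vs\<close> \<open>set vs \<subseteq> set us\<close> by (metis List.finite_set card_mono distinct_card)
    ultimately show ?thesis using card_distinct card_length[of us] le_antisym le_trans by metis
  qed
  have n: "2 \<le> ?n" using us'(1,6) by (cases us; cases "tl us") auto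
  \<comment> \<open>The colour of an inner neighbour of \<open>v\<close> differs from that of one of
    the two ends; the piece of the walk between them would be shorter.\<close>
  have no_chord_v: "i = 0 \<or> Suc i = ?n" if i: "i < ?n" "adj v (us ! i)" for i
  proof (rule ccontr)
    assume neg: "\<not> ?thesis"
    have hl: "hd (drop i us) = us ! i" "last (take (Suc i) us) = us ! i"
      using i(1) by (auto simp: hd_drop_conv_nth take_Suc_conv_app_nth)
    have "\<phi> (us ! i) \<noteq> \<phi> (hd us) \<or> \<phi> (us ! i) \<noteq> \<phi> (last us)" using us'(6) by auto
    then show False
    proof
      assume ne: "\<phi> (us ! i) \<noteq> \<phi> (hd us)"
      have "Q (take (Suc i) us)"
        using suc(1)[of "Suc i"] sub(1)[of "Suc i"] hl(2) i us'(1,4) ne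
        unfolding Q_def by simp
      from least[OF this] show False using neg i by auto
    next
      assume ne: "\<phi> (us ! i) \<noteq> \<phi> (last us)"
      have "Q (drop i us)"
        using suc(2)[of i] sub(2)[of i] hl(1) i us'(1,5) ne
        unfolding Q_def by simp
      from least[OF this] show False using neg i by auto
    qed
  qed
  have no_chord: "j = Suc i" if ij: "i < j" "j < ?n" "adj (us ! i) (us ! j)" for i j
  proof (rule ccontr)
    assume neg: "j \<noteq> Suc i"
    let ?ws = "take (Suc i) us @ drop j us"
    have hl: "hd (drop j us) = us ! j" "last (take (Suc i) us) = us ! i"
      using ij by (auto simp: hd_drop_conv_nth take_Suc_conv_app_nth)
    have "successively adj ?ws" unfolding successively_append_iff
      using suc(1)[of "Suc i"] suc(2)[of j] hl ij(3) by simp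
    moreover have "hd ?ws = hd us" "last ?ws = last us"
      using ij us'(1) by (auto simp: hd_append)
    moreover have "set ?ws \<subseteq> V - {v}" using sub(1)[of "Suc i"] sub(2)[of j] by auto
    moreover have "?ws \<noteq> []" using us'(1) by simp
    ultimately have "Q ?ws" using us'(4,5,6) unfolding Q_def by simp
    from least[OF this] show False using ij neg by auto
  qed
  have "adj ((v # us) ! i) ((v # us) ! j) \<longleftrightarrow>
      j = Suc i \<or> j = 0 \<and> Suc i = Suc ?n \<or> i = Suc j \<or> i = 0 \<and> Suc j = Suc ?n"
    if ij: "i < Suc ?n" "j < Suc ?n" for i j
  proof -
    have main: "adj ((v # us) ! i) ((v # us) ! j) \<longleftrightarrow> j = Suc i \<or> i = 0 \<and> Suc j = Suc ?n"
      if lt: "i < j" "j < Suc ?n" for i j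
    proof (cases i)
      case 0
      obtain j' where j': "j = Suc j'" using lt by (cases j) auto
      have "adj v (us ! 0)" "adj v (us ! (?n - 1))"
        using us' by (simp_all add: hd_conv_nth last_conv_nth)
      then show ?thesis using no_chord_v[of j'] 0 j' lt
        by (cases "Suc j' = ?n") auto
    next
      case (Suc i')
      obtain j' where j': "j = Suc j'" using lt by (cases j) auto
      show ?thesis using no_chord[of i' j'] successively_nth[OF us'(3), of i'] Suc j' lt by auto
    qed
    consider "i < j" | "i = j" | "j < i" by linarith
    then show ?thesis
    proof cases
      case 1
      show ?thesis using main[OF 1 ij(2)] 1 ij by linarith
    next
      case 2
      then show ?thesis using adj_irrefl n by auto
    next
      case 3
      show ?thesis
        using main[OF 3 ij(1)] 3 ij adj_sym[of "(v # us) ! i" "(v # us) ! j"] by linarith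
    qed
  qed
  then have "induced_cycle (v # us)"
    unfolding induced_cycle_def using distinct us'(2) n hole_in_V[OF v(1)]
    by (auto simp: cong_Suc_iff)
  then have "bad_cycle (v # us) \<phi>"
    using v us' by (auto simp: bad_cycle_def hd_conv_nth)
  then show ?thesis by blast
qed

section \<open>Ears\<close>

text \<open>A path from outside reaches \<open>K\<close> at some \<open>v\<close>, and a path
  avoiding \<open>v\<close> leads from the vertex before it to a second vertex of \<open>K\<close>;
  cut off at its first hit, it is an ear. A shortest ear has no repeated vertex and no later
  neighbour of its starting point.\<close>

lemma ex_ear:
  assumes K: "K \<subseteq> V" "K \<noteq> V" "a \<in> K" "b \<in> K" "a \<noteq> b"
  obtains v v' us where "v \<in> K" "v' \<in> K" "v \<noteq> v'" "us \<noteq> []" "set us \<inter> K = {}" "distinct us"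
    "successively adj us" "adj v (hd us)" "adj (last us) v'" "\<And>w. w \<in> set (tl us) \<Longrightarrow> \<not> adj v w"
proof -
  define Q where "Q us \<longleftrightarrow> us \<noteq> [] \<and> set us \<inter> K = {} \<and> successively adj us \<and>
    (\<exists>v v'. v \<in> K \<and> v' \<in> K \<and> v \<noteq> v' \<and> adj v (hd us) \<and> adj (last us) v')" for us
  have first_hit: "\<exists>ys v. ys \<noteq> [] \<and> hd ys = hd xs \<and> set ys \<inter> K = {} \<and> successively adj ys \<and>
      v \<in> K \<and> v \<in> set xs \<and> adj (last ys) v"
    if xs: "xs \<noteq> []" "hd xs \<notin> K" "last xs \<in> K" "successively adj xs" for xs
  proof -
    have "\<exists>v\<in>set xs. v \<in> K" using xs last_in_set by blast
    from split_list_first_prop[OF this] obtain ys v zs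
      where s: "xs = ys @ v # zs" "v \<in> K" "\<forall>w\<in>set ys. w \<notin> K" by blast
    have "ys \<noteq> []" using s xs(2) by (cases ys) auto
    then show ?thesis using s xs(4) by (intro exI[of _ ys] exI[of _ v]) (auto simp: successively_append_iff)
  qed
  obtain x where x: "x \<in> V" "x \<notin> K" using K by blast
  have "a \<in> V" using K by blast
  obtain xs where xs: "xs \<noteq> []" "hd xs = x" "last xs = a" "successively adj xs"
    using path_between[OF x(1) \<open>a \<in> V\<close>, of "{}"] by blast
  obtain ys v where ys: "ys \<noteq> []" "set ys \<inter> K = {}" "v \<in> K" "adj (last ys) v"
    using first_hit[of xs] xs x K(3) by blast
  define u where "u = last ys"
  have u: "u \<notin> K" "adj u v" using ys last_in_set unfolding u_def by blast+
  obtain b' where b': "b' \<in> K" "b' \<noteq> v" using K(3-5) by metis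
  have "u \<in> V" "b' \<in> V" "u \<notin> {v}" "b' \<notin> {v}" using u b' K(1) adj_in_V ys(3) by blast+
  then obtain zs where zs: "zs \<noteq> []" "hd zs = u" "last zs = b'" "set zs \<subseteq> V - {v}" "successively adj zs"
    using path_between[of u b' "{v}" v] by blast
  obtain ws v' where ws: "ws \<noteq> []" "hd ws = u" "set ws \<inter> K = {}" "successively adj ws"
      "v' \<in> K" "v' \<in> set zs" "adj (last ws) v'"
    using first_hit[of zs] zs u(1) b'(1) by auto
  have "Q ws" unfolding Q_def using ws ys(3) u(2) zs(4) adj_sym[of u v] by blast
  then obtain us where us: "Q us" and least: "\<And>ws. Q ws \<Longrightarrow> length us \<le> length ws"
    using ex_has_least_nat[of Q _ length] by blast
  obtain v v' where v: "v \<in> K" "v' \<in> K" "v \<noteq> v'" "adj v (hd us)" "adj (last us) v'"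
    using us unfolding Q_def by blast
  have us': "us \<noteq> []" "set us \<inter> K = {}" "successively adj us" using us by (auto simp: Q_def)
  have distinct: "distinct us"
  proof -
    obtain vs where vs: "vs \<noteq> []" "hd vs = hd us" "last vs = last us" "set vs \<subseteq> set us" "distinct vs"
      "successively adj vs" using walk_contains_path[OF us'(3,1)] by blast
    then have "Q vs" using us' v unfolding Q_def by auto
    then have "length us \<le> length vs" by (rule least)
    also have "length vs \<le> card (set us)"
      using vs by (metis List.finite_set card_mono distinct_card)
    finally show ?thesis using card_distinct card_length[of us] le_antisym by metis
  qed
  \<comment> \<open>Starting at a later neighbour \<open>w\<close> of \<open>v\<close> would give a
    shorter ear with the same two vertices of \<open>K\<close>.\<close>
  have "\<not> adj v w" if w: "w \<in> set (tl us)" for w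
  proof
    assume adj: "adj v w"
    obtain i where i: "i < length (tl us)" "tl us ! i = w" using w by (auto simp: in_set_conv_nth)
    let ?ws = "drop (Suc i) us"
    have ne: "?ws \<noteq> []" using i by auto
    have hd: "hd ?ws = w" using i by (simp add: hd_drop_conv_nth nth_tl)
    have "us = take (Suc i) us @ ?ws" by simp
    then have "successively adj ?ws" using us'(3) by (metis successively_append_iff)
    moreover have "set ?ws \<inter> K = {}" using us'(2) set_drop_subset[of "Suc i" us] by blast
    moreover have "last ?ws = last us" using ne by simp
    ultimately have "Q ?ws" unfolding Q_def using ne hd v adj by metis
    from least[OF this] show False using us'(1) by (cases us) auto
  qed
  then show thesis using that v us' distinct by blast
qed

text \<open>The ear, continued by a path \<open>ps\<close> inside \<open>K\<close> back to
  \<open>v\<close>, is a cycle on which the hole has just two neighbours, so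
  \<open>two_neighbours_on_cycle\<close> applies. Varying \<open>ps\<close> or the colouring then
  yields contradictions.\<close>

lemma ear_colour:
  assumes "S v \<phi>" "v \<in> K" "us \<noteq> []" "set us \<inter> K = {}" "distinct us" "successively adj us"
    "adj v (hd us)" "\<And>w. w \<in> set (tl us) \<Longrightarrow> \<not> adj v w"
    and ps: "ps \<noteq> []" "set ps \<subseteq> K - {v}" "distinct ps" "successively adj ps" "adj (last us) (hd ps)"
      "adj (last ps) v" "\<And>w. w \<in> set ps \<Longrightarrow> adj v w \<Longrightarrow> w = last ps"
  shows "\<phi> ((us @ ps) ! 1) = \<phi> (last ps)"
proof -
  have "v \<notin> set us" using assms(2,4) by blast
  then have cyc: "cycle_at v (us @ ps)"
    using assms ps by (auto simp: cycle_at_def successively_Cons successively_append_iff)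
  have two: "w = hd (us @ ps) \<or> w = last (us @ ps)" if "w \<in> set (us @ ps)" "adj v w" for w
  proof (cases "w \<in> set us")
    case True
    then have "w = hd us" using assms(3,8) that(2) by (cases us) auto
    then show ?thesis using assms(3) by simp
  next
    case False
    then show ?thesis using that ps(1,7) by auto
  qed
  have "2 \<le> length (us @ ps)" using assms(3) ps(1) by (cases us; cases ps) auto
  from two_neighbours_on_cycle(1)[OF assms(1) cyc this two] show ?thesis using ps(1) by simp
qed

section \<open>Bidirected cliques showing two colours\<close>

definition bad_clique :: "'a set \<Rightarrow> bool" where
  "bad_clique K \<longleftrightarrow> K \<subseteq> V \<and> (\<forall>u\<in>K. \<forall>w\<in>K. u \<noteq> w \<longrightarrow> (u, w) \<in> A) \<and>
    (\<exists>v \<phi> x y. S v \<phi> \<and> v \<in> K \<and> x \<in> K - {v} \<and> y \<in> K - {v} \<and> \<phi> x \<noteq> \<phi> y)"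

lemma bad_clique_adj: "bad_clique K \<Longrightarrow> u \<in> K \<Longrightarrow> w \<in> K \<Longrightarrow> u \<noteq> w \<Longrightarrow> adj u w"
  by (auto simp: bad_clique_def adj_def)

text \<open>Sliding the hole from \<open>h\<close> to \<open>v\<close> moves the colour of
  \<open>v\<close> to \<open>h\<close> and changes nothing else, so the clique still shows the same
  colours.\<close>

lemma bad_clique_at:
  assumes K: "bad_clique K" and v: "v \<in> K"
  obtains \<phi> x y where "S v \<phi>" "x \<in> K - {v}" "y \<in> K - {v}" "\<phi> x \<noteq> \<phi> y"
proof -
  obtain h \<phi> x y where h: "S h \<phi>" "h \<in> K" "x \<in> K - {h}" "y \<in> K - {h}" "\<phi> x \<noteq> \<phi> y"
    using K unfolding bad_clique_def by blast
  show thesis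
  proof (cases "h = v")
    case True
    then show thesis using h that by blast
  next
    case False
    have S: "S v (\<phi>(h := \<phi> v))" using slide_adj[OF h(1)] bad_clique_adj[OF K h(2) v False] by blast
    \<comment> \<open>\<open>h\<close> takes over the role of \<open>v\<close>, whose colour it now
      carries.\<close>
    show thesis
      by (rule that[OF S, of "if x = v then h else x" "if y = v then h else y"])
        (use h False in auto)
  qed
qed

text \<open>Two swaps contradict invariance. If \<open>u\<close> misses a vertex of
  \<open>K\<close>, a neighbour and a non-neighbour of \<open>u\<close> with different colours are
  swapped before the hole moves to \<open>u\<close>. If an arc between \<open>u\<close> and
  \<open>y\<close> is missing in one direction, the hole is put on \<open>y\<close> and the colour
  of \<open>u\<close> is swapped with a different colour of the clique.\<close>

lemma bad_clique_insert:
  assumes K: "bad_clique K" and u: "u \<notin> K" "v \<in> K" "x \<in> K" "v \<noteq> x" "adj u v" "adj u x"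
  shows "bad_clique (insert u K)"
proof -
  have adj_all: "adj u y" if y: "y \<in> K" for y
  proof (rule ccontr)
    assume neg: "\<not> adj u y"
    obtain \<phi> p q where \<phi>: "S v \<phi>" "p \<in> K - {v}" "q \<in> K - {v}" "\<phi> p \<noteq> \<phi> q"
      using bad_clique_at[OF K u(2)] by blast
    \<comment> \<open>Otherwise \<open>K - {v}\<close> would have one colour only: neighbours of
      \<open>u\<close> are compared with \<open>y\<close>, and non-neighbours with
      \<open>x\<close>.\<close>
    have "\<exists>x' y'. x' \<in> K - {v} \<and> y' \<in> K - {v} \<and> adj u x' \<and> \<not> adj u y' \<and> \<phi> x' \<noteq> \<phi> y'"
    proof (rule ccontr)
      assume no: "\<not> ?thesis"
      have "x \<in> K - {v}" "y \<in> K - {v}" using u y neg by auto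
      then have "\<phi> w = \<phi> x" if "w \<in> K - {v}" for w
        using no u(6) neg that by metis
      then show False using \<phi> by metis
    qed
    then obtain x' y' where xy: "x' \<in> K - {v}" "y' \<in> K - {v}" "adj u x'" "\<not> adj u y'" "\<phi> x' \<noteq> \<phi> y'"
      by blast
    have "adj v x'" "adj x' y'" "adj y' v" using bad_clique_adj[OF K] xy u(2) by auto
    from swap_triangle[OF \<phi>(1) this] obtain \<psi> where \<psi>: "S v \<psi>" "\<psi> x' = \<phi> y'" "\<psi> y' = \<phi> x'"
        "\<And>w. w \<noteq> x' \<Longrightarrow> w \<noteq> y' \<Longrightarrow> w \<noteq> v \<Longrightarrow> \<psi> w = \<phi> w" by blast
    have vu: "adj v u" using u(5) adj_sym by blast
    have S: "S u (\<phi>(v := \<phi> u))" "S u (\<psi>(v := \<psi> u))" using slide_adj vu \<phi>(1) \<psi>(1) by blast+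
    have eq: "(\<phi>(v := \<phi> u)) w = (\<psi>(v := \<psi> u)) w" if "w \<notin> {x', y'}" for w
    proof (cases "w = v")
      case True
      have "u \<noteq> x'" "u \<noteq> y'" "u \<noteq> v" using xy u(1,2) by auto
      then show ?thesis using \<psi>(4)[of u] True by simp
    qed (use that \<psi>(4)[of w] in simp)
    obtain R where R: "R = A \<or> R = A\<inverse>" "(u, x') \<in> R" using xy(3) by (auto simp: adj_def)
    \<comment> \<open>Of the two recoloured vertices the hole \<open>u\<close> sees only
      \<open>x'\<close>.\<close>
    have "R `` {u} \<inter> {x', y'} = {x'}" using R xy(4) by (auto simp: adj_def)
    then show False
      using colours_at_hole_local[OF S R(1), of "{x', y'}"] eq xy \<psi>(2) by auto
  qed
  have arcs: "(y, u) \<in> R" if y: "y \<in> K" and R: "R = A \<or> R = A\<inverse>" for y R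
  proof (rule ccontr)
    assume neg: "(y, u) \<notin> R"
    obtain \<phi> p q where \<phi>: "S y \<phi>" "p \<in> K - {y}" "q \<in> K - {y}" "\<phi> p \<noteq> \<phi> q"
      using bad_clique_at[OF K y] by blast
    then obtain z where z: "z \<in> K" "z \<noteq> y" "\<phi> z \<noteq> \<phi> u" by (metis Diff_iff singletonI)
    have "adj y u" "adj u z" "adj z y"
      using adj_all y z bad_clique_adj[OF K z(1) y z(2)] adj_sym by blast+
    from swap_triangle[OF \<phi>(1) this] obtain \<psi> where \<psi>: "S y \<psi>" "\<psi> u = \<phi> z" "\<psi> z = \<phi> u"
        "\<And>w. w \<noteq> u \<Longrightarrow> w \<noteq> z \<Longrightarrow> w \<noteq> y \<Longrightarrow> \<psi> w = \<phi> w" by blast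
    have "(y, z) \<in> R" using K y z R by (auto simp: bad_clique_def)
    \<comment> \<open>In direction \<open>R\<close> the hole \<open>y\<close> sees \<open>z\<close>
      but not \<open>u\<close>, although the swap has changed the colour of
      \<open>z\<close>.\<close>
    then have "R `` {y} \<inter> {u, z} = {z}" using neg by auto
    then show False
      using colours_at_hole_local[OF \<phi>(1) \<psi>(1) R, of "{u, z}"] \<psi> z(3) by auto
  qed
  have "u \<in> V" using u(5) adj_in_V by blast
  then show ?thesis
    using K u(1) arcs[of _ A] arcs[of _ "A\<inverse>"] unfolding bad_clique_def by blast
qed

text \<open>A bad clique of maximum size that missed a vertex would have an ear. An ear with a
  single vertex outside could be added to the clique. On a longer ear the second vertex shares the
  colour of \<open>v'\<close> in every colouring with hole \<open>v\<close>, which a swap inside the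
  clique refutes.\<close>

lemma bad_clique_spans:
  assumes "bad_clique K"
  shows "bad_clique V"
proof -
  have card: "card K \<le> card V" if "bad_clique K" for K
    using that finite_V by (auto simp: bad_clique_def intro: card_mono)
  obtain K where K: "bad_clique K" and max: "\<And>K'. bad_clique K' \<Longrightarrow> card K' \<le> card K"
    using ex_has_greatest_nat[of bad_clique K card "Suc (card V)"] assms card
    by (auto simp: less_Suc_eq_le)
  have KV: "K \<subseteq> V" using K by (simp add: bad_clique_def)
  have "K = V"
  proof (rule ccontr)
    assume "K \<noteq> V"
    moreover obtain a b where "a \<in> K" "b \<in> K" "a \<noteq> b" using K unfolding bad_clique_def by blast
    ultimately obtain v v' us where e: "v \<in> K" "v' \<in> K" "v \<noteq> v'" "us \<noteq> []" "set us \<inter> K = {}"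
        "distinct us" "successively adj us" "adj v (hd us)" "adj (last us) v'"
        "\<And>w. w \<in> set (tl us) \<Longrightarrow> \<not> adj v w"
      using ex_ear[OF KV] by metis
    show False
    proof (cases "tl us = []")
      case True
      then obtain u where us: "us = [u]" using e(4) by (cases us) auto
      then have "bad_clique (insert u K)"
        using bad_clique_insert[OF K _ e(1-3), of u] e adj_sym by auto
      moreover have "card (insert u K) = Suc (card K)"
        using us e(5) finite_subset[OF KV finite_V] by simp
      ultimately show False using max by fastforce
    next
      case False
      then have us1: "us ! 1 \<notin> K" "(us @ [v']) ! 1 = us ! 1" using e(5)
        by (cases us; cases "tl us"; auto)+
      have same: "\<phi> (us ! 1) = \<phi> v'" if "S v \<phi>" for \<phi>
        using ear_colour[OF that e(1,4-8,10), of "[v']"] e(2,3,9) us1(2)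
          bad_clique_adj[OF K e(1-3)] adj_sym by auto
      obtain \<phi> p q where \<phi>: "S v \<phi>" "p \<in> K - {v}" "q \<in> K - {v}" "\<phi> p \<noteq> \<phi> q"
        using bad_clique_at[OF K e(1)] by blast
      then obtain y where y: "y \<in> K" "y \<noteq> v" "\<phi> y \<noteq> \<phi> v'" by (metis Diff_iff singletonI)
      have "adj v v'" "adj v' y" "adj y v"
        using bad_clique_adj[OF K] e(1-3) y by auto
      from swap_triangle[OF \<phi>(1) this] obtain \<psi> where \<psi>: "S v \<psi>" "\<psi> v' = \<phi> y"
          "\<And>w. w \<noteq> v' \<Longrightarrow> w \<noteq> y \<Longrightarrow> w \<noteq> v \<Longrightarrow> \<psi> w = \<phi> w" by blast
      have "\<psi> (us ! 1) = \<phi> (us ! 1)" using \<psi>(3) us1(1) e(1,2) y(1) by metis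
      then show False using same[OF \<phi>(1)] same[OF \<psi>(1)] \<psi>(2) y(3) by metis
    qed
  qed
  then show ?thesis using K by simp
qed

section \<open>Bad cycles of length at least five\<close>

text \<open>With the hole at \<open>v\<close>, an ear ending at \<open>v'\<close> can be closed
  along a part of the cycle on either side of \<open>v'\<close>. This ties the colour of the second
  vertex after the hole to that of \<open>last ws\<close> or of \<open>hd ws\<close>, and exchanging
  the two colours of the cycle breaks the tie.\<close>

lemma long_bad_cycle_spans:
  assumes "bad_cycle c \<phi>" "5 \<le> length c"
  shows "set c = V"
proof (rule ccontr)
  assume neq: "set c \<noteq> V"
  let ?K = "set c"
  have KV: "?K \<subseteq> V" "distinct c" using assms(1) by (auto simp: bad_cycle_def induced_cycle_def)
  obtain a b where "a \<in> ?K" "b \<in> ?K" "a \<noteq> b"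
    using KV(2) assms(2) by (metis List.finite_set card_le_Suc0_iff_eq distinct_card numeral_le_one_iff
        order_trans semiring_norm(70) One_nat_def)
  then obtain v v' us where e: "v \<in> ?K" "v' \<in> ?K" "v \<noteq> v'" "us \<noteq> []" "set us \<inter> ?K = {}"
      "distinct us" "successively adj us" "adj v (hd us)" "adj (last us) v'"
      "\<And>w. w \<in> set (tl us) \<Longrightarrow> \<not> adj v w"
    using ex_ear[OF KV(1) neq] by metis
  obtain m where m: "m < length c" "c ! m = v" using e(1) by (auto simp: in_set_conv_nth)
  obtain \<psi> where \<psi>: "bad_cycle (rotate m c) \<psi>" using bad_cycle_rotate[OF assms(1)] by blast
  have "c \<noteq> []" using m(1) by auto
  then have "rotate m c \<noteq> []" "hd (rotate m c) = v" using m by (simp_all add: hd_rotate_conv_nth)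
  then obtain ws where ws: "rotate m c = v # ws" by (metis list.collapse)
  have K: "?K = set (v # ws)" "length ws = length c - 1"
    using arg_cong[OF ws, of set] arg_cong[OF ws, of length] by auto
  let ?n = "length ws"
  have bad: "bad_cycle (v # ws) \<psi>" using \<psi> ws by simp
  have cyc: "induced_cycle (v # ws)" using bad by (simp add: bad_cycle_def)
  note at = induced_cycle_at[OF cyc]
  have n: "4 \<le> ?n" "ws \<noteq> []" using K(2) assms(2) by auto
  have d: "distinct (v # ws)" "successively adj ws" "adj v (hd ws)" "adj (last ws) v"
    using at(1) n(2) by (auto simp: cycle_at_def successively_Cons)
  obtain i where i: "i < ?n" "ws ! i = v'" using e(2,3) K(1) by (auto simp: in_set_conv_nth)
  have suc: "successively adj (drop j ws)" "successively adj (rev (take j ws))" for j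
  proof -
    have "ws = take j ws @ drop j ws" by simp
    then have "successively adj (drop j ws)" "successively adj (take j ws)"
      using d(2) by (metis successively_append_iff)+
    then show "successively adj (drop j ws)" "successively adj (rev (take j ws))"
      by (metis adj_sym_fun successively_rev)+
  qed
  have nd: "set (drop j ws) \<subseteq> ?K - {v}" "set (take j ws) \<subseteq> ?K - {v}" for j
    using d(1) K(1) set_drop_subset[of j ws] set_take_subset[of j ws] by auto
  have hd_drop: "hd (drop i ws) = v'" "drop i ws \<noteq> []" "last (drop i ws) = last ws"
    using i by (auto simp: hd_drop_conv_nth)
  \<comment> \<open>The condition \<open>0 < i\<close> keeps \<open>hd ws\<close>, the other cycle
    neighbour of \<open>v\<close>, off the part of the cycle that is used.\<close>
  have right: "\<phi> ((us @ drop i ws) ! 1) = \<phi> (last ws)" if "S v \<phi>" "0 < i" for \<phi>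
  proof -
    have "hd ws \<notin> set (drop i ws)"
      using that(2) d(1) n(2) set_drop_subset[of "i - 1" "tl ws"] by (cases ws; cases i) (auto dest: in_set_dropD)
    then have "w = last (drop i ws)" if "w \<in> set (drop i ws)" "adj v w" for w
      using at(2)[of w] that hd_drop(3) in_set_dropD by metis
    from ear_colour[OF that(1) e(1,4-8,10) hd_drop(2) nd(1) _ suc(1) _ _ this] show ?thesis
      using hd_drop d e(9) by simp
  qed
  \<comment> \<open>Here the cycle is read backwards from \<open>v'\<close> to \<open>hd ws\<close>,
    and \<open>Suc i < ?n\<close> keeps \<open>last ws\<close> off that part.\<close>
  have left: "\<phi> ((us @ rev (take (Suc i) ws)) ! 1) = \<phi> (hd ws)" if "S v \<phi>" "Suc i < ?n" for \<phi>
  proof -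
    let ?ps = "rev (take (Suc i) ws)"
    have hl: "hd ?ps = v'" "?ps \<noteq> []" "last ?ps = hd ws"
      using i n(2) by (auto simp: hd_rev last_rev take_Suc_conv_app_nth hd_append take_eq_Nil hd_conv_nth)
    have "last ws \<notin> set (take (Suc i) ws)"
    proof
      assume "last ws \<in> set (take (Suc i) ws)"
      moreover have "last ws \<in> set (drop (Suc i) ws)"
        using that(2) by (metis drop_eq_Nil last_drop last_in_set linorder_not_less)
      ultimately show False using d(1) set_take_disj_set_drop_if_distinct[of ws "Suc i" "Suc i"] by auto
    qed
    then have "w = last ?ps" if "w \<in> set ?ps" "adj v w" for w
      using at(2)[of w] that hl(3) in_set_takeD by (metis set_rev)
    from ear_colour[OF that(1) e(1,4-8,10) hl(2) _ _ suc(2) _ _ this] show ?thesis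
      using hl d e(9) nd(2)[of "Suc i"] adj_sym by simp
  qed
  obtain \<chi> where \<chi>: "bad_cycle (v # ws) \<chi>" "\<chi> (hd ws) = \<psi> (last ws)" "\<chi> (last ws) = \<psi> (hd ws)"
      "\<And>w. w \<notin> ?K \<Longrightarrow> \<chi> w = \<psi> w"
    using bad_cycle_swap[OF bad] K(1) by metis
  have ne: "\<psi> (hd ws) \<noteq> \<psi> (last ws)" using bad_cycle_hd_last[OF bad] .
  have S: "S v \<psi>" "S v \<chi>" using bad \<chi>(1) by (auto simp: bad_cycle_def)
  show False
  proof (cases "tl us = []")
    case False
    then have us1: "us ! 1 \<notin> ?K" "(us @ ps) ! 1 = us ! 1" for ps using e(5)
      by (cases us; cases "tl us"; auto)+
    \<comment> \<open>At least one of \<open>left\<close> and \<open>right\<close> applies, and it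
      would make the colour of \<open>us ! 1\<close> change under the exchange, although this vertex
      is off the cycle.\<close>
    have "\<chi> (us ! 1) = \<psi> (us ! 1)" using \<chi>(4) us1(1) by blast
    then show False
      using right[OF S(1)] right[OF S(2)] left[OF S(1)] left[OF S(2)] us1(2) \<chi>(2,3) ne n
      by (cases "i = 0") auto
  next
    case True
    then obtain u where us: "us = [u]" using e(4) by (cases us) auto
    show False
    proof (cases "i = 0 \<or> Suc i = ?n")
      case False
      \<comment> \<open>With a single ear vertex the second vertex is \<open>v'\<close> on both
        sides, so its colour would equal both colours of the cycle.\<close>
      have "(us @ drop i ws) ! 1 = v'" using us hd_drop by (simp add: hd_conv_nth)
      moreover have "(us @ rev (take (Suc i) ws)) ! 1 = v'" using us i by (simp add: take_Suc_conv_app_nth)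
      ultimately show False using right[OF S(1)] left[OF S(1)] False i ne by auto
    next
      case True
      then have end_v': "v' = hd ws \<or> v' = last ws"
        using i n(2) by (metis diff_Suc_1 hd_conv_nth last_conv_nth)
      \<comment> \<open>Now \<open>v\<close>, \<open>u\<close>, \<open>v'\<close> form a triangle.
        Swapping \<open>u\<close> and \<open>v'\<close> does not touch the vertex two places from
        \<open>v'\<close>, yet that vertex shares the colour of \<open>v'\<close> in every colouring
        with hole \<open>v\<close>.\<close>
      have same: "\<phi> u = \<phi> v'" if "bad_cycle (v # ws) \<phi>" for \<phi>
      proof -
        have S: "S v \<phi>" using that by (simp add: bad_cycle_def)
        have "adj v' v" using end_v' d(3,4) adj_sym by blast
        then obtain \<theta> where \<theta>: "S v \<theta>" "\<theta> u = \<phi> v'" "\<theta> v' = \<phi> u"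
            "\<And>w. w \<noteq> u \<Longrightarrow> w \<noteq> v' \<Longrightarrow> w \<noteq> v \<Longrightarrow> \<theta> w = \<phi> w"
          using swap_triangle[OF S, of u v'] e us by auto
        \<comment> \<open>Two places from \<open>v'\<close>, counted towards the side on which
          \<open>ws\<close> continues.\<close>
        define j where "j = (if i = 0 then 2 else i - 2)"
        have "j < ?n" "j \<noteq> i" using True i(1) n(1) by (auto simp: j_def)
        then have j: "j < ?n" "ws ! j \<noteq> v'"
          using i d(1) nth_eq_iff_index_eq[of ws j i] by auto
        have "ws ! j \<in> ?K" "ws ! j \<noteq> v" using K(1) d(1) j(1) nth_mem by fastforce+
        moreover from this have "ws ! j \<noteq> u" using us e(5) by auto
        ultimately have "\<theta> (ws ! j) = \<phi> (ws ! j)" using \<theta>(4) j(2) by blast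
        moreover have "\<xi> (ws ! j) = \<xi> v'" if "S v \<xi>" for \<xi>
          using induced_cycle_colours[OF cyc that, of 0] induced_cycle_colours[OF cyc that, of "i - 2"]
            True i n by (auto simp: j_def numeral_2_eq_2 Suc_diff_Suc)
        ultimately show ?thesis using \<theta>(1,3) S by metis
      qed
      \<comment> \<open>The exchange changes the colour of \<open>v'\<close> but not that of
        \<open>u\<close>.\<close>
      have "u \<notin> ?K" using us e(5) by auto
      then have "\<chi> v' = \<psi> v'" using same[OF bad] same[OF \<chi>(1)] \<chi>(4) by metis
      then show False using end_v' \<chi>(2,3) ne by metis
    qed
  qed
qed

text \<open>A bad cycle of length three is a bad clique, so all of \<open>V\<close> is one; an odd
  cycle of any other length has at least five vertices and already spans.\<close>

theorem nonconstant_imp_complete_or_odd_cycle: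
  assumes "S v \<phi>" "x \<in> V" "y \<in> V" "x \<noteq> v" "y \<noteq> v" "\<phi> x \<noteq> \<phi> y"
  shows "(\<forall>u\<in>V. \<forall>w\<in>V. u \<noteq> w \<longrightarrow> (u, w) \<in> A) \<or>
    (\<exists>c. distinct c \<and> set c = V \<and> odd (length c) \<and> 3 \<le> length c \<and>
      (\<forall>i < length c. \<forall>j < length c. (c ! i, c ! j) \<in> A \<longleftrightarrow>
        [j = Suc i] (mod length c) \<or> [i = Suc j] (mod length c)))"
proof -
  obtain c \<phi> where bad: "bad_cycle c \<phi>" using ex_bad_cycle[OF assms] by blast
  then have c: "induced_cycle c" "distinct c" "3 \<le> length c" "odd (length c)" "set c \<subseteq> V"
    using bad_cycle_odd by (auto simp: bad_cycle_def induced_cycle_def)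
  show ?thesis
  proof (cases "length c = 3")
    case True
    then obtain p q r where pqr: "c = [p, q, r]" by (auto simp: numeral_3_eq_3 length_Suc_conv)
    have "(c ! i, c ! j) \<in> A" if "i < 3" "j < 3" "i \<noteq> j" for i j
    proof -
      have "i \<in> {0, 1, 2}" "j \<in> {0, 1, 2}" using that by auto
      then have "[j = Suc i] (mod 3) \<or> [i = Suc j] (mod 3)" using that(3) by (auto simp: cong_def)
      then show ?thesis using bad_cycle_bidirected[OF bad, of i j] that True by simp
    qed
    from this[of 0 1] this[of 1 0] this[of 0 2] this[of 2 0] this[of 1 2] this[of 2 1]
    have "\<forall>u\<in>set c. \<forall>w\<in>set c. u \<noteq> w \<longrightarrow> (u, w) \<in> A" using pqr by auto
    moreover have "S p \<phi> \<and> p \<in> set c \<and> q \<in> set c - {p} \<and> r \<in> set c - {p} \<and> \<phi> q \<noteq> \<phi> r"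
      using bad pqr c(2) by (auto simp: bad_cycle_def)
    ultimately have "bad_clique (set c)" unfolding bad_clique_def using c(5) by blast
    from bad_clique_spans[OF this] show ?thesis by (auto simp: bad_clique_def)
  next
    case False
    then have "5 \<le> length c" using c(3,4) by presburger
    from long_bad_cycle_spans[OF bad this] show ?thesis using c bad_cycle_bidirected[OF bad] by blast
  qed
qed

end

section \<open>Isomorphisms, critical subdigraphs and blocks\<close>

lemma arcs_ends_induce: "arcs_ends (G \<restriction> U) = arcs_ends G \<inter> U \<times> U"
  by (auto simp: arcs_ends_conv)

lemma arcs_ends_in_verts: "digraph G \<Longrightarrow> arcs_ends G \<subseteq> verts G \<times> verts G"
  unfolding digraph_def fin_digraph_def wf_digraph_def by (auto simp: arcs_ends_conv)

lemma no_loop_arcs_ends: "digraph G \<Longrightarrow> (u, u) \<notin> arcs_ends G"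
  using loopfree_digraph.adj_not_same[of G u] by (auto simp: digraph_def)

lemma finite_verts_digraph: "digraph G \<Longrightarrow> finite (verts G)"
  unfolding digraph_def by (blast dest: fin_digraph.finite_verts)

lemma digraph_induce: "digraph G \<Longrightarrow> U \<subseteq> verts G \<Longrightarrow> digraph (G \<restriction> U)"
proof -
  assume "digraph G" and U: "U \<subseteq> verts G"
  then interpret digraph G by simp
  from subgraph_induce_subgraphI[OF U] show "digraph (G \<restriction> U)" by (rule digraph_subgraph)
qed

lemma digraph_with_projI:
  assumes "finite (pverts G)" "parcs G \<subseteq> pverts G \<times> pverts G" "irrefl (parcs G)"
  shows "digraph (with_proj G)"
proof -
  have "finite (parcs G)" using assms(1,2) finite_subset by blast
  then interpret pair_digraph G
  proof unfold_locales
    show "fst e \<in> pverts G" "snd e \<in> pverts G" "fst e \<noteq> snd e" if "e \<in> parcs G" for e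
      using that assms(2,3) by (auto simp: irrefl_def)
  qed (use assms(1) in simp_all)
  show ?thesis by (rule digraph_axioms)
qed

text \<open>Without parallel arcs an arc is determined by its ends, so counting arcs at
  \<open>v\<close> becomes counting neighbours.\<close>

lemma out_degree_conv: "digraph G \<Longrightarrow> out_degree G v = card (arcs_ends G `` {v})"
  and in_degree_conv: "digraph G \<Longrightarrow> in_degree G v = card ((arcs_ends G)\<inverse> `` {v})"
proof -
  assume "digraph G"
  then interpret digraph G .
  have "out_degree G v = card (arc_to_ends G ` out_arcs G v)"
    unfolding out_degree_def
    by (rule card_image[symmetric]) (auto intro: inj_on_subset[OF inj_on_arc_to_ends])
  also have "\<dots> = card (snd ` arc_to_ends G ` out_arcs G v)"
    by (rule card_image[symmetric]) (auto simp: inj_on_def arc_to_ends_def)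
  also have "snd ` arc_to_ends G ` out_arcs G v = arcs_ends G `` {v}"
    by (force simp: arcs_ends_conv arc_to_ends_def)
  finally show "out_degree G v = card (arcs_ends G `` {v})" .
  have "in_degree G v = card (arc_to_ends G ` in_arcs G v)"
    unfolding in_degree_def
    by (rule card_image[symmetric]) (auto intro: inj_on_subset[OF inj_on_arc_to_ends])
  also have "\<dots> = card (fst ` arc_to_ends G ` in_arcs G v)"
    by (rule card_image[symmetric]) (auto simp: inj_on_def arc_to_ends_def)
  also have "fst ` arc_to_ends G ` in_arcs G v = (arcs_ends G)\<inverse> `` {v}"
    by (force simp: arcs_ends_conv arc_to_ends_def)
  finally show "in_degree G v = card ((arcs_ends G)\<inverse> `` {v})" .
qed

text \<open>The arc map is forced by the vertex map: each arc goes to the unique arc of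
  \<open>H\<close> with the image ends.\<close>

lemma digraph_isoI:
  assumes G: "digraph G" and H: "digraph H" and f: "bij_betw f (verts G) (verts H)"
    and arcs: "\<And>u v. u \<in> verts G \<Longrightarrow> v \<in> verts G \<Longrightarrow> (u, v) \<in> arcs_ends G \<longleftrightarrow> (f u, f v) \<in> arcs_ends H"
  shows "digraph_iso G H"
proof -
  interpret G: digraph G by (rule G)
  interpret H: digraph H by (rule H)
  let ?e = "\<lambda>a. (f (tail G a), f (head G a))"
  define g where "g a = the_inv_into (arcs H) (arc_to_ends H) (?e a)" for a
  have im: "?e ` arcs G = arcs_ends H"
  proof (intro equalityI subsetI)
    fix x assume "x \<in> arcs_ends H"
    moreover obtain p q where x: "x = (p, q)" by (cases x) auto
    ultimately have "p \<in> f ` verts G" "q \<in> f ` verts G" "(p, q) \<in> arcs_ends H"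
      using H.adj_in_verts f by (auto simp: bij_betw_def)
    then obtain u v where "u \<in> verts G" "v \<in> verts G" "p = f u" "q = f v" by blast
    with arcs \<open>(p, q) \<in> _\<close> have "(u, v) \<in> arcs_ends G" by auto
    with x \<open>p = f u\<close> \<open>q = f v\<close> show "x \<in> ?e ` arcs G" by (auto simp: arcs_ends_conv)
  next
    fix x assume "x \<in> ?e ` arcs G"
    then obtain a where a: "a \<in> arcs G" "x = ?e a" by blast
    then have "(tail G a, head G a) \<in> arcs_ends G" by (auto simp: arcs_ends_conv)
    then show "x \<in> arcs_ends H" using arcs a by simp
  qed
  have inj: "inj_on ?e (arcs G)"
  proof (rule inj_onI)
    fix a b assume ab: "a \<in> arcs G" "b \<in> arcs G" "?e a = ?e b"
    then have "arc_to_ends G a = arc_to_ends G b"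
      using f by (auto simp: arc_to_ends_def bij_betw_def dest: inj_onD)
    then show "a = b" using G.no_multi_arcs ab by blast
  qed
  have g: "g a \<in> arcs H" "arc_to_ends H (g a) = ?e a" if "a \<in> arcs G" for a
  proof -
    have *: "?e a \<in> arc_to_ends H ` arcs H" using im that by (auto simp: arcs_ends_def)
    show "g a \<in> arcs H" unfolding g_def
      by (rule the_inv_into_into[OF H.inj_on_arc_to_ends *]) simp
    show "arc_to_ends H (g a) = ?e a" unfolding g_def
      by (rule f_the_inv_into_f[OF H.inj_on_arc_to_ends *])
  qed
  have inj_g: "inj_on g (arcs G)"
  proof (rule inj_onI)
    fix a b assume ab: "a \<in> arcs G" "b \<in> arcs G" "g a = g b"
    then have "?e a = ?e b" using g(2) by metis
    then show "a = b" using inj ab by (auto dest: inj_onD)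
  qed
  have "g ` arcs G = arcs H"
  proof (intro equalityI subsetI)
    fix b assume b: "b \<in> arcs H"
    then have "arc_to_ends H b \<in> ?e ` arcs G" using im by (auto simp: arcs_ends_def)
    then obtain a where "a \<in> arcs G" "arc_to_ends H b = ?e a" by blast
    then have "b = g a" using g[of a] H.no_multi_arcs b by metis
    then show "b \<in> g ` arcs G" using \<open>a \<in> arcs G\<close> by blast
  qed (use g in auto)
  let ?hom = "\<lparr>iso_verts = f, iso_arcs = g, iso_head = head H, iso_tail = tail H\<rparr>"
  have "G.digraph_isomorphism ?hom"
    using f g inj_g by (auto simp: G.digraph_isomorphism_def bij_betw_def arc_to_ends_def G.wf_digraph)
  moreover have "H = app_iso ?hom G"
    using f \<open>g ` arcs G = arcs H\<close> by (auto simp: app_iso_def bij_betw_def)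
  ultimately show ?thesis unfolding digraph_iso_def by blast
qed

lemma digraph_isoE:
  assumes "digraph_iso G H"
  obtains f where "bij_betw f (verts G) (verts H)"
    "\<And>u v. u \<in> verts G \<Longrightarrow> v \<in> verts G \<Longrightarrow> (u, v) \<in> arcs_ends G \<longleftrightarrow> (f u, f v) \<in> arcs_ends H"
    "\<And>v. v \<in> verts G \<Longrightarrow> out_degree H (f v) = out_degree G v"
    "\<And>v. v \<in> verts G \<Longrightarrow> in_degree H (f v) = in_degree G v"
proof -
  obtain h where h: "pre_digraph.digraph_isomorphism G h" "H = app_iso h G"
    using assms unfolding digraph_iso_def by blast
  interpret wf_digraph G using h(1) by (simp add: pre_digraph.digraph_isomorphism_def)
  show thesis
  proof (rule that[of "iso_verts h"])
    show "bij_betw (iso_verts h) (verts G) (verts H)"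
      using h by (auto simp: bij_betw_def digraph_isomorphism_def)
    fix u v assume uv: "u \<in> verts G" "v \<in> verts G"
    show "(u, v) \<in> arcs_ends G \<longleftrightarrow> (iso_verts h u, iso_verts h v) \<in> arcs_ends H"
    proof
      assume "(iso_verts h u, iso_verts h v) \<in> arcs_ends H"
      then obtain u' v' where uv': "(u', v') \<in> arcs_ends G" "iso_verts h u = iso_verts h u'"
          "iso_verts h v = iso_verts h v'"
        unfolding h(2) arcs_ends_app_iso_eq[OF h(1)] by auto
      then have "u = u'" "v = v'" using uv adj_in_verts[OF uv'(1)] iso_verts_eq_iff[OF h(1)] by auto
      then show "(u, v) \<in> arcs_ends G" using uv' by simp
    qed (force simp: h(2) arcs_ends_app_iso_eq[OF h(1)])
  qed (use h out_degree_app_iso_eq in_degree_app_iso_eq in auto)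
qed

lemma wf_digraphI: "digraph G \<Longrightarrow> wf_digraph G"
  by (simp add: digraph_def fin_digraph_def)

lemma has_property_iso:
  assumes "digraph G" "digraph_iso G H"
  shows "has_property P G \<longleftrightarrow> has_property P H"
proof
  assume "has_property P G"
  then obtain G' where "G' \<in> P" "digraph_iso G (with_proj G')" unfolding has_property_def by blast
  moreover have "digraph_iso H G" by (rule digraph_iso_swap[OF wf_digraphI[OF assms(1)] assms(2)])
  ultimately show "has_property P H" unfolding has_property_def using digraph_iso_trans by blast
next
  assume "has_property P H"
  then obtain G' where "G' \<in> P" "digraph_iso H (with_proj G')" unfolding has_property_def by blast
  then show "has_property P G"
    unfolding has_property_def using digraph_iso_trans[OF assms(2)] by blast
qed

lemma digraph_iso_induce:
  assumes G: "digraph G" and H: "digraph H" and f: "bij_betw f (verts G) (verts H)"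
    and arcs: "\<And>u v. u \<in> verts G \<Longrightarrow> v \<in> verts G \<Longrightarrow> (u, v) \<in> arcs_ends G \<longleftrightarrow> (f u, f v) \<in> arcs_ends H"
    and U: "U \<subseteq> verts G"
  shows "digraph_iso (G \<restriction> U) (H \<restriction> (f ` U))"
proof (rule digraph_isoI[of _ _ f])
  show "digraph (G \<restriction> U)" using G U by (rule digraph_induce)
  have sub: "f ` U \<subseteq> verts H" using f U by (auto simp: bij_betw_def)
  then show "digraph (H \<restriction> (f ` U))" using H by (intro digraph_induce)
  show "bij_betw f (verts (G \<restriction> U)) (verts (H \<restriction> f ` U))"
    using f U by (auto simp: bij_betw_def intro: inj_on_subset)
  show "(u, v) \<in> arcs_ends (G \<restriction> U) \<longleftrightarrow> (f u, f v) \<in> arcs_ends (H \<restriction> f ` U)"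
    if "u \<in> verts (G \<restriction> U)" "v \<in> verts (G \<restriction> U)" for u v
    using that arcs[of u v] U by (auto simp: arcs_ends_induce)
qed

text \<open>Numbering the vertices moves a digraph to the type over which properties,
  \<open>d_out\<close> and \<open>d_in\<close> are defined.\<close>

lemma ex_iso_nat:
  assumes "digraph G"
  obtains G' :: "nat pair_pre_digraph" where "digraph (with_proj G')" "digraph_iso G (with_proj G')"
proof -
  interpret digraph G by (rule assms)
  obtain f where f: "bij_betw f (verts G) {0..<card (verts G)}"
    using ex_bij_betw_finite_nat[OF finite_verts] by blast
  define G' where "G' = \<lparr>pverts = f ` verts G, parcs = (\<lambda>(u, v). (f u, f v)) ` arcs_ends G\<rparr>"
  have inj: "inj_on f (verts G)" using f by (auto simp: bij_betw_def)
  have "digraph (with_proj G')"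
  proof (intro digraph_with_projI)
    show "finite (pverts G')" by (simp add: G'_def)
    show "parcs G' \<subseteq> pverts G' \<times> pverts G'"
      using arcs_ends_in_verts[OF assms] by (auto simp: G'_def)
    have "f u \<noteq> f v" if "(u, v) \<in> arcs_ends G" for u v
      using that no_loop_arcs_ends[OF assms] adj_in_verts[OF that] inj_on_eq_iff[OF inj] by metis
    then show "irrefl (parcs G')" by (auto simp: G'_def irrefl_def; metis)
  qed
  moreover have "digraph_iso G (with_proj G')"
  proof (rule digraph_isoI[OF assms \<open>digraph (with_proj G')\<close>, of f])
    show "bij_betw f (verts G) (verts (with_proj G'))" using inj by (simp add: G'_def bij_betw_def)
    show "(u, v) \<in> arcs_ends G \<longleftrightarrow> (f u, f v) \<in> arcs_ends (with_proj G')"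
      if "u \<in> verts G" "v \<in> verts G" for u v
    proof
      assume "(f u, f v) \<in> arcs_ends (with_proj G')"
      then obtain u' v' where uv': "(u', v') \<in> arcs_ends G" "f u = f u'" "f v = f v'"
        by (auto simp: G'_def)
      then have "u = u'" "v = v'" using that adj_in_verts[OF uv'(1)] inj_on_eq_iff[OF inj] by auto
      then show "(u, v) \<in> arcs_ends G" using uv' by simp
    qed (force simp: G'_def)
  qed
  ultimately show thesis using that by blast
qed

section \<open>Reliable properties and their critical digraphs\<close>

lemma has_property_hereditary:
  assumes P: "reliable P" and G: "digraph G" "has_property P G" and U: "U \<subseteq> verts G"
  shows "has_property P (G \<restriction> U)"
proof -
  obtain G' where G': "G' \<in> P" "digraph_iso G (with_proj G')"
    using G(2) unfolding has_property_def by blast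
  have dG': "digraph (with_proj G')" using P G'(1) by (auto simp: reliable_def is_digraph_property_def)
  obtain f where f: "bij_betw f (verts G) (verts (with_proj G'))"
    "\<And>u v. u \<in> verts G \<Longrightarrow> v \<in> verts G \<Longrightarrow>
      (u, v) \<in> arcs_ends G \<longleftrightarrow> (f u, f v) \<in> arcs_ends (with_proj G')"
    by (rule digraph_isoE[OF G'(2)]) (rule that; assumption)
  let ?W = "f ` U"
  let ?G'' = "\<lparr>pverts = ?W, parcs = parcs G' \<inter> ?W \<times> ?W\<rparr>"
  have eq: "with_proj ?G'' = with_proj G' \<restriction> ?W"
    by (auto simp: with_proj_def induce_subgraph_def)
  have "?W \<subseteq> verts (with_proj G')" using f(1) U by (auto simp: bij_betw_def)
  then have "induced_subgraph (with_proj ?G'') (with_proj G')"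
    unfolding eq using wf_digraph.induced_induce[OF wf_digraphI[OF dG']] by blast
  then have "?G'' \<in> P" using P G'(1) unfolding reliable_def hereditary_def by blast
  moreover have "digraph_iso (G \<restriction> U) (with_proj ?G'')"
    unfolding eq by (rule digraph_iso_induce[OF G(1) dG' f U])
  ultimately show ?thesis unfolding has_property_def by blast
qed

text \<open>Some member exists, and heredity yields its empty subdigraph, to which every null
  digraph is isomorphic.\<close>

lemma has_property_null:
  assumes P: "reliable P" and G: "digraph G" "verts G = {}"
  shows "has_property P G"
proof -
  obtain G' where G': "G' \<in> P" using P by (auto simp: reliable_def nontrivial_def)
  have dG': "digraph (with_proj G')" using P G' by (auto simp: reliable_def is_digraph_property_def)
  have "has_property P (with_proj G')"
    using G' digraph_isoI[OF dG' dG', of id] unfolding has_property_def by auto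
  then have *: "has_property P (with_proj G' \<restriction> {})"
    using has_property_hereditary[OF P dG'] by blast
  have d: "digraph (with_proj G' \<restriction> {})" using digraph_induce[OF dG'] by blast
  \<comment> \<open>Any function is a bijection between empty sets, hence
    \<open>undefined\<close>.\<close>
  have "digraph_iso G (with_proj G' \<restriction> {})"
    by (rule digraph_isoI[OF G(1) d, of undefined]) (auto simp: G(2) bij_betw_def)
  then show ?thesis using has_property_iso[OF G(1)] * by blast
qed

lemma del_vert_conv_induce:
  assumes "wf_digraph G"
  shows "pre_digraph.del_vert G v = G \<restriction> (verts G - {v})"
  using assms by (auto simp: pre_digraph.del_vert_def induce_subgraph_def wf_digraph_def)

lemma induce_verts: "wf_digraph G \<Longrightarrow> G \<restriction> verts G = G"
  by (intro pre_digraph.equality) (auto simp: wf_digraph_def)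

lemma induce_induce: "W \<subseteq> U \<Longrightarrow> (G \<restriction> U) \<restriction> W = G \<restriction> W"
  by (auto simp: induce_subgraph_def)

text \<open>The degrees of a property are minima over digraphs on natural numbers, so the critical
  digraph is first moved there; criticality and degrees are carried along.\<close>

lemma CR_degrees:
  assumes P: "reliable P" and G: "CR P G" and v: "v \<in> verts G"
  shows "d_out P \<le> out_degree G v" "d_in P \<le> in_degree G v"
proof -
  have dG: "digraph G" using G by (simp add: CR_def)
  obtain G' :: "nat pair_pre_digraph" where G': "digraph (with_proj G')" "digraph_iso G (with_proj G')"
    using ex_iso_nat[OF dG] by blast
  obtain f where f: "bij_betw f (verts G) (verts (with_proj G'))"
    "\<And>u v. u \<in> verts G \<Longrightarrow> v \<in> verts G \<Longrightarrow>
      (u, v) \<in> arcs_ends G \<longleftrightarrow> (f u, f v) \<in> arcs_ends (with_proj G')"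
    "\<And>v. v \<in> verts G \<Longrightarrow> out_degree (with_proj G') (f v) = out_degree G v"
    "\<And>v. v \<in> verts G \<Longrightarrow> in_degree (with_proj G') (f v) = in_degree G v"
    by (rule digraph_isoE[OF G'(2)]) (rule that; assumption)
  have "CR P (with_proj G')"
    unfolding CR_def
  proof (intro conjI ballI)
    show "digraph (with_proj G')" by (rule G'(1))
    show "\<not> has_property P (with_proj G')"
      using G has_property_iso[OF dG G'(2)] by (auto simp: CR_def)
    fix w assume "w \<in> verts (with_proj G')"
    then obtain u where u: "u \<in> verts G" "w = f u" using f(1) by (auto simp: bij_betw_def)
    have "has_property P (G \<restriction> (verts G - {u}))"
      using G u(1) del_vert_conv_induce[OF wf_digraphI[OF dG]] by (auto simp: CR_def)
    moreover have "f ` (verts G - {u}) = verts (with_proj G') - {w}"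
      using f(1) u by (auto simp: bij_betw_def inj_on_def)
    then have "digraph_iso (G \<restriction> (verts G - {u})) (with_proj G' \<restriction> (verts (with_proj G') - {w}))"
      using digraph_iso_induce[OF dG G'(1) f(1,2), of "verts G - {u}"] by simp
    moreover have "digraph (G \<restriction> (verts G - {u}))" using digraph_induce[OF dG] by simp
    ultimately show "has_property P (pre_digraph.del_vert (with_proj G') w)"
      unfolding del_vert_conv_induce[OF wf_digraphI[OF G'(1)]] using has_property_iso by blast
  qed
  then have "d_out P \<le> min_out_degree (with_proj G')" "d_in P \<le> min_in_degree (with_proj G')"
    unfolding d_out_def d_in_def by (auto intro!: Least_le)
  moreover have fv: "f v \<in> verts (with_proj G')" using f(1) v by (auto simp: bij_betw_def)
  have "finite (verts (with_proj G'))" by (rule finite_verts_digraph[OF G'(1)])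
  then have "min_out_degree (with_proj G') \<le> out_degree (with_proj G') (f v)"
    "min_in_degree (with_proj G') \<le> in_degree (with_proj G') (f v)"
    unfolding min_out_degree_def min_in_degree_def using fv by (auto intro!: Min_le)
  ultimately show "d_out P \<le> out_degree G v" "d_in P \<le> in_degree G v"
    using f(3,4)[OF v] by auto
qed

text \<open>A smallest vertex set inducing a nonmember is critical. By heredity it lies in no set
  that induces a member; this last clause will force a chosen vertex into \<open>U\<close>.\<close>

lemma ex_CR_induced:
  assumes P: "reliable P" and G: "digraph G" and neg: "\<not> has_property P G"
  obtains U where "U \<noteq> {}" "U \<subseteq> verts G" "CR P (G \<restriction> U)"
    "\<And>Y. Y \<subseteq> verts G \<Longrightarrow> has_property P (G \<restriction> Y) \<Longrightarrow> \<not> U \<subseteq> Y"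
proof -
  let ?Q = "\<lambda>U. U \<subseteq> verts G \<and> \<not> has_property P (G \<restriction> U)"
  have "?Q (verts G)" using neg induce_verts[OF wf_digraphI[OF G]] by simp
  then obtain U where U: "?Q U" and min: "\<And>W. ?Q W \<Longrightarrow> card U \<le> card W"
    using ex_has_least_nat[of ?Q "verts G" card] by blast
  have fin: "finite U" using U finite_subset finite_verts_digraph[OF G] by blast
  have dU: "digraph (G \<restriction> U)" using digraph_induce[OF G] U by blast
  have "has_property P (G \<restriction> (U - {v}))" if "v \<in> U" for v
  proof (rule ccontr)
    assume "\<not> ?thesis"
    then have "card U \<le> card (U - {v})" using U min by blast
    then show False using card_Diff1_less[OF fin that] by simp
  qed
  then have "CR P (G \<restriction> U)"
    unfolding CR_def del_vert_conv_induce[OF wf_digraphI[OF dU]]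
    using U dU by (auto simp: induce_induce)
  moreover have "U \<noteq> {}" using U has_property_null[OF P dU] by auto
  moreover have "\<not> U \<subseteq> Y" if "Y \<subseteq> verts G" "has_property P (G \<restriction> Y)" for Y
  proof
    assume UY: "U \<subseteq> Y"
    have "has_property P ((G \<restriction> Y) \<restriction> U)"
      using has_property_hereditary[OF P digraph_induce[OF G that(1)] that(2)] UY by simp
    then show False using U unfolding induce_induce[OF UY] by simp
  qed
  ultimately show thesis using that U by blast
qed

section \<open>Connectivity, components and blocks\<close>

lemma connected_imp_path:
  assumes "connected G" "x \<in> verts G" "y \<in> verts G"
  shows "\<exists>us. us \<noteq> [] \<and> hd us = x \<and> last us = y \<and> set us \<subseteq> verts G \<and>
    successively (\<lambda>u v. (u, v) \<in> arcs_ends G \<or> (v, u) \<in> arcs_ends G) us"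
proof -
  have "(x, y) \<in> rtrancl_on (verts G) ((arcs_ends G)\<^sup>s)"
    using assms by (auto simp: connected_conv)
  then show ?thesis
  proof (induction rule: rtrancl_on_induct)
    case base
    then show ?case by (intro exI[of _ "[x]"]) auto
  next
    case (step u v)
    then obtain us where "us \<noteq> []" "hd us = x" "last us = u" "set us \<subseteq> verts G"
      "successively (\<lambda>u v. (u, v) \<in> arcs_ends G \<or> (v, u) \<in> arcs_ends G) us" by blast
    with step show ?case
      by (intro exI[of _ "us @ [v]"]) (auto simp: successively_append_iff symcl_def)
  qed
qed

lemma ex_component:
  assumes G: "digraph G" and u: "u \<in> verts G"
  shows "\<exists>C \<in> components G. u \<in> verts C"
proof -
  interpret digraph G by (rule G)
  define Q where "Q C \<longleftrightarrow> subgraph C G \<and> connected C \<and> u \<in> verts C" for C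
  \<comment> \<open>Subgraphs need not be induced, so the size to be maximized counts vertices and
    arcs together.\<close>
  define m where "m C = card (verts C) + card (arcs C)" for C :: "('a, 'b) pre_digraph"
  let ?U = "\<lparr>verts = {u}, arcs = {}, tail = tail G, head = head G\<rparr>"
  have "wf_digraph ?U" by unfold_locales auto
  then have "Q ?U" using u wf_digraph
    by (auto simp: Q_def subgraph_def compatible_def connected_conv)
  moreover have bound: "m C \<le> m G" if "Q C" for C
    using that by (auto simp: Q_def m_def subgraph_def intro!: add_mono card_mono)
  then have "\<forall>C. Q C \<longrightarrow> m C < Suc (m G)" by (auto simp: less_Suc_eq_le)
  ultimately obtain C where C: "Q C" and max: "\<And>C'. Q C' \<Longrightarrow> m C' \<le> m C"
    using ex_has_greatest_nat[of Q ?U m "Suc (m G)"] by blast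
  have "C' = C" if C': "subgraph C C'" "subgraph C' G" "connected C'" for C'
  proof -
    have sub: "verts C \<subseteq> verts C'" "arcs C \<subseteq> arcs C'" "compatible C' C"
      using C'(1) by (auto simp: subgraph_def)
    have fin: "finite (verts C')" "finite (arcs C')"
      using C'(2) finite_subset[of _ "verts G"] finite_subset[of _ "arcs G"] by (auto simp: subgraph_def)
    have "Q C'" using C' C sub(1) by (auto simp: Q_def)
    then have le: "card (verts C') + card (arcs C') \<le> card (verts C) + card (arcs C)"
      using max unfolding m_def by blast
    have "card (verts C) \<le> card (verts C')" "card (arcs C) \<le> card (arcs C')"
      using sub fin by (auto intro: card_mono)
    then have "verts C = verts C'" "arcs C = arcs C'"
      using le sub fin card_subset_eq[of "verts C'" "verts C"] card_subset_eq[of "arcs C'" "arcs C"]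
      by linarith+
    then show ?thesis using sub(3) by (auto simp: compatible_def)
  qed
  then have "max_subgraph connected C" using C by (auto simp: Q_def max_subgraph_def)
  then show ?thesis using C by (auto simp: components_def Q_def)
qed

lemma card_components_less_2_iff:
  assumes G: "digraph G"
  shows "card (components G) < 2 \<longleftrightarrow> verts G = {} \<or> connected G"
proof
  interpret digraph G by (rule G)
  assume less: "card (components G) < 2"
  \<comment> \<open>Finiteness comes first, because an infinite set of components would have
    \<open>card\<close> 0.\<close>
  have "inj_on (\<lambda>C. (verts C, arcs C)) {C. subgraph C G}"
    by (intro inj_onI) (auto simp: subgraph_def compatible_def)
  moreover have "(\<lambda>C. (verts C, arcs C)) ` {C. subgraph C G} \<subseteq> Pow (verts G) \<times> Pow (arcs G)"
    by (auto simp: subgraph_def)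
  ultimately have "finite {C. subgraph C G}"
    using finite_verts finite_arcs by (meson finite_Pow_iff finite_SigmaI finite_subset inj_on_finite)
  then have "finite (components G)"
    by (rule finite_subset[rotated]) (auto simp: components_def max_subgraph_def)
  then have uniq: "C = C'" if "C \<in> components G" "C' \<in> components G" for C C'
    using less that card_le_Suc0_iff_eq[of "components G"] by auto
  show "verts G = {} \<or> connected G"
  proof (cases "verts G = {}")
    case False
    then obtain u where "u \<in> verts G" by blast
    then obtain C where C: "C \<in> components G" using ex_component[OF G] by blast
    then have "verts G \<subseteq> verts C" using ex_component[OF G] uniq by blast
    then have "spanning C G" "connected C"
      using C by (auto simp: components_def max_subgraph_def spanning_def subgraph_def)
    then show ?thesis using connected_spanning_imp_connected by blast
  qed simp
next
  interpret digraph G by (rule G)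
  assume "verts G = {} \<or> connected G"
  then have "components G \<subseteq> {G}"
  proof
    assume "verts G = {}"
    then show ?thesis by (auto simp: components_def max_subgraph_def subgraph_def connected_conv)
  next
    assume c: "connected G"
    show ?thesis
    proof
      fix C assume "C \<in> components G"
      then have "max_subgraph connected C" by (simp add: components_def)
      then show "C \<in> {G}" using c subgraph_refl unfolding max_subgraph_def by auto
    qed
  qed
  then have "card (components G) \<le> card {G}" by (intro card_mono) auto
  then show "card (components G) < 2" by simp
qed

text \<open>The null digraph is not \<open>connected\<close> but has fewer than two components;
  therefore some vertex must remain.\<close>

lemma separating_vertex_iff:
  assumes "digraph G"
  shows "separating_vertex G v \<longleftrightarrow>
    v \<in> verts G \<and> verts G - {v} \<noteq> {} \<and> \<not> connected (G \<restriction> (verts G - {v}))"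
proof -
  have "digraph (G \<restriction> (verts G - {v}))" using digraph_induce[OF assms] by simp
  from card_components_less_2_iff[OF this] show ?thesis
    unfolding separating_vertex_def del_vert_conv_induce[OF wf_digraphI[OF assms]]
    by (auto simp: not_less[symmetric])
qed

text \<open>Adding to \<open>B\<close> all arcs of \<open>G\<close> between its vertices keeps it
  connected and creates no separating vertex, so by maximality no arc was missing.\<close>

lemma block_induced:
  assumes G: "digraph G" and B: "is_block G B"
  shows "verts B \<subseteq> verts G" "B = G \<restriction> verts B"
proof -
  interpret digraph G by (rule G)
  have sub: "subgraph B G" and conn: "connected B" and nsep: "\<And>v. \<not> separating_vertex B v"
    and max: "\<And>B'. subgraph B B' \<Longrightarrow> subgraph B' G \<Longrightarrow> connected B' \<Longrightarrow>
      (\<nexists>v. separating_vertex B' v) \<Longrightarrow> B' = B"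
    using B unfolding is_block_def max_subgraph_def by blast+
  show V: "verts B \<subseteq> verts G" using sub by (auto simp: subgraph_def)
  let ?B' = "G \<restriction> verts B"
  have dB: "digraph B" using digraph_subgraph[OF sub] .
  have dB': "digraph ?B'" using digraph_induce[OF G V] .
  have sub1: "subgraph B ?B'" by (rule subgraph_induce_subgraphI2[OF sub])
  have sub2: "subgraph ?B' G" by (rule subgraph_induce_subgraphI[OF V])
  have conn': "connected ?B'"
    using wf_digraph.connected_spanning_imp_connected[OF wf_digraphI[OF dB'] _ conn] sub1
    by (auto simp: spanning_def)
  have "\<not> separating_vertex ?B' v" for v
  proof
    assume sep: "separating_vertex ?B' v"
    let ?W = "verts B - {v}"
    have W: "v \<in> verts B" "?W \<noteq> {}" "\<not> connected (?B' \<restriction> ?W)"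
      using sep unfolding separating_vertex_iff[OF dB'] by simp_all
    have "connected (B \<restriction> ?W)" using nsep[of v] W(1,2) unfolding separating_vertex_iff[OF dB] by blast
    moreover have "digraph (?B' \<restriction> ?W)" "digraph (B \<restriction> ?W)"
      using digraph_induce[OF dB', of ?W] digraph_induce[OF dB, of ?W] by auto
    moreover from this have "spanning (B \<restriction> ?W) (?B' \<restriction> ?W)"
      using sub1 wf_digraphI unfolding spanning_def subgraph_def compatible_def by auto
    ultimately show False
      using W(3) wf_digraph.connected_spanning_imp_connected[OF wf_digraphI] by blast
  qed
  then show "B = ?B'" using max[OF sub1 sub2 conn'] by auto
qed

text \<open>Establishes \<open>path_avoiding\<close>: an empty \<open>Z\<close> expresses
  connectedness, a singleton the absence of separating vertices.\<close>

lemma block_path_avoiding: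
  assumes G: "digraph G" and B: "is_block G B"
    and xy: "x \<in> verts B" "y \<in> verts B" "Z = {} \<or> Z = {z}" "x \<notin> Z" "y \<notin> Z"
  shows "\<exists>us. us \<noteq> [] \<and> hd us = x \<and> last us = y \<and> set us \<subseteq> verts B - Z \<and>
    successively (\<lambda>u v. (u, v) \<in> arcs_ends B \<or> (v, u) \<in> arcs_ends B) us"
proof -
  have dB: "digraph B"
    using block_induced[OF G B] digraph_induce[OF G] by metis
  have conn: "connected B" and nsep: "\<And>v. \<not> separating_vertex B v"
    using B unfolding is_block_def pre_digraph.max_subgraph_def by blast+
  have "connected (B \<restriction> (verts B - Z))"
  proof (cases "verts B \<inter> Z = {}")
    case True
    then have "verts B - Z = verts B" by blast
    then show ?thesis using conn induce_verts[OF wf_digraphI[OF dB]] by simp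
  next
    case False
    then have Z: "Z = {z}" "z \<in> verts B" using xy(3) by auto
    then show ?thesis using nsep[of z] xy unfolding separating_vertex_iff[OF dB] by auto
  qed
  from connected_imp_path[OF this, of x y] xy obtain us
    where us: "us \<noteq> []" "hd us = x" "last us = y" "set us \<subseteq> verts B - Z"
      "successively (\<lambda>u v. (u, v) \<in> arcs_ends (B \<restriction> (verts B - Z)) \<or>
        (v, u) \<in> arcs_ends (B \<restriction> (verts B - Z))) us"
    by auto
  have "successively (\<lambda>u v. (u, v) \<in> arcs_ends B \<or> (v, u) \<in> arcs_ends B) us"
    by (rule successively_mono[OF us(5)]) (auto simp: arcs_ends_induce)
  then show ?thesis using us by blast
qed

section \<open>Critical list covers\<close>

lemma iso_bidirected_complete:
  assumes B: "digraph B" and complete: "\<And>u w. u \<in> verts B \<Longrightarrow> w \<in> verts B \<Longrightarrow> u \<noteq> w \<Longrightarrow> (u, w) \<in> arcs_ends B"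
  shows "digraph_iso B (with_proj (bidirected_complete (card (verts B))))"
proof -
  let ?n = "card (verts B)"
  have arcs: "parcs (bidirected_complete ?n) = {(i, j). i < ?n \<and> j < ?n \<and> i \<noteq> j}"
    by (auto simp: bidirected_complete_def bidirection_def doubleton_eq_iff)
  have verts: "pverts (bidirected_complete ?n) = {..<?n}"
    by (simp add: bidirected_complete_def bidirection_def)
  obtain f where f: "bij_betw f (verts B) {..<?n}"
    using ex_bij_betw_finite_nat[OF finite_verts_digraph[OF B]] by (auto simp: atLeast0LessThan)
  show ?thesis
  proof (rule digraph_isoI[OF B, of _ f])
    show "digraph (with_proj (bidirected_complete ?n))"
      by (rule digraph_with_projI) (auto simp: arcs verts irrefl_def)
    show "bij_betw f (verts B) (verts (with_proj (bidirected_complete ?n)))" using f verts by simp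
    fix u w assume uw: "u \<in> verts B" "w \<in> verts B"
    then have "f u < ?n" "f w < ?n" "f u = f w \<longleftrightarrow> u = w"
      using f by (auto simp: bij_betw_def inj_on_eq_iff)
    then show "(u, w) \<in> arcs_ends B \<longleftrightarrow> (f u, f w) \<in> arcs_ends (with_proj (bidirected_complete ?n))"
      using complete[OF uw] no_loop_arcs_ends[OF B] by (auto simp: arcs)
  qed
qed

lemma iso_bidirected_cycle:
  assumes B: "digraph B" and c: "distinct c" "set c = verts B" "3 \<le> length c"
    and arcs_B: "\<And>i j. i < length c \<Longrightarrow> j < length c \<Longrightarrow> (c ! i, c ! j) \<in> arcs_ends B \<longleftrightarrow>
      [j = Suc i] (mod length c) \<or> [i = Suc j] (mod length c)"
  shows "digraph_iso B (with_proj (bidirected_cycle (length c)))"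
proof -
  let ?n = "length c" and ?C = "with_proj (bidirected_cycle (length c))"
  have verts: "verts ?C = {..<?n}" by (simp add: bidirected_cycle_def bidirection_def)
  have arcs: "(i, j) \<in> arcs_ends ?C \<longleftrightarrow> [j = Suc i] (mod ?n) \<or> [i = Suc j] (mod ?n)"
    if "i < ?n" "j < ?n" for i j
  proof -
    \<comment> \<open>As the length is at least 3, no index is its own successor, and the ends are
      distinct as \<open>bidirection\<close> demands.\<close>
    have neq: "Suc i mod ?n \<noteq> i" using that c(3) by (auto simp: mod_Suc)
    have "(i, j) \<in> arcs_ends ?C \<longleftrightarrow> i \<noteq> j \<and> (j = Suc i mod ?n \<or> i = Suc j mod ?n)"
      using that by (auto simp: bidirected_cycle_def bidirection_def doubleton_eq_iff)
    also have "\<dots> \<longleftrightarrow> j = Suc i mod ?n \<or> i = Suc j mod ?n" using neq by auto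
    finally show ?thesis using that by (simp add: cong_def)
  qed
  have in_verts: "arcs_ends ?C \<subseteq> verts ?C \<times> verts ?C"
  proof -
    have "c \<noteq> []" using c(3) by auto
    then show ?thesis by (auto simp: bidirected_cycle_def bidirection_def doubleton_eq_iff)
  qed
  have dC: "digraph ?C"
  proof (rule digraph_with_projI)
    show "irrefl (parcs (bidirected_cycle ?n))"
      by (auto simp: irrefl_def bidirected_cycle_def bidirection_def)
  qed (use in_verts verts in auto)
  \<comment> \<open>Indexing the list maps positions to vertices, so the isomorphism starts from the
    standard cycle and is then reversed.\<close>
  have "digraph_iso ?C B"
  proof (rule digraph_isoI[OF dC B, of "(!) c"])
    show "bij_betw ((!) c) (verts ?C) (verts B)"
      using bij_betw_nth[OF c(1) refl c(2)[symmetric]] verts by simp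
    show "(i, j) \<in> arcs_ends ?C \<longleftrightarrow> (c ! i, c ! j) \<in> arcs_ends B"
      if "i \<in> verts ?C" "j \<in> verts ?C" for i j
      using arcs[of i j] arcs_B[of i j] that verts by auto
  qed
  then show ?thesis by (rule digraph_iso_swap[OF wf_digraphI[OF dC]])
qed

section \<open>Colourings in place of transversals\<close>

text \<open>
  For the list cover, \<open>monochromatic D \<phi> W\<close> stands for \<open>H[T]\<close> with \<open>T = {(w, \<phi> w) | w \<in> W}\<close>.
\<close>

definition monochromatic ::
    "('a, 'b) pre_digraph \<Rightarrow> ('a \<Rightarrow> 'c) \<Rightarrow> 'a set \<Rightarrow> ('a, 'a \<times> 'a) pre_digraph" where
  "monochromatic D \<phi> W = with_proj \<lparr>pverts = W,
     parcs = {(u, w) \<in> arcs_ends D. u \<in> W \<and> w \<in> W \<and> \<phi> u = \<phi> w}\<rparr>"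

lemma verts_monochromatic [simp]: "verts (monochromatic D \<phi> W) = W"
  and arcs_ends_monochromatic:
    "arcs_ends (monochromatic D \<phi> W) = {(u, w) \<in> arcs_ends D. u \<in> W \<and> w \<in> W \<and> \<phi> u = \<phi> w}"
  by (simp_all add: monochromatic_def)

lemma digraph_monochromatic:
  assumes "digraph D" "W \<subseteq> verts D"
  shows "digraph (monochromatic D \<phi> W)"
  unfolding monochromatic_def
  using finite_subset[OF assms(2) finite_verts_digraph[OF assms(1)]] no_loop_arcs_ends[OF assms(1)]
  by (intro digraph_with_projI) (auto simp: irrefl_def)

lemma monochromatic_induce: "U \<subseteq> W \<Longrightarrow> monochromatic D \<phi> W \<restriction> U = monochromatic D \<phi> U"
  by (auto simp: monochromatic_def with_proj_def induce_subgraph_def)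

lemma monochromatic_cong:
  "(\<And>w. w \<in> W \<Longrightarrow> \<phi> w = \<psi> w) \<Longrightarrow> monochromatic D \<phi> W = monochromatic D \<psi> W"
  unfolding monochromatic_def by (rule arg_cong[of _ _ with_proj]) auto

text \<open>Pairing each vertex with its colour is an isomorphism, since the arcs of the cover join
  equal colours only.\<close>

lemma has_property_list_cover:
  assumes D: "digraph D" and W: "W \<subseteq> verts D" and H: "H = snd (list_cover D L)" "digraph H"
    and \<phi>: "\<And>w. w \<in> W \<Longrightarrow> \<phi> w \<in> L w"
  shows "has_property P (H \<restriction> ((\<lambda>w. (w, \<phi> w)) ` W)) \<longleftrightarrow> has_property P (monochromatic D \<phi> W)"
proof -
  let ?f = "\<lambda>w. (w, \<phi> w)"
  have sub: "?f ` W \<subseteq> verts H" using W \<phi> by (auto simp: H(1) list_cover_def)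
  have "digraph_iso (monochromatic D \<phi> W) (H \<restriction> (?f ` W))"
  proof (rule digraph_isoI[OF digraph_monochromatic[OF D W] digraph_induce[OF H(2) sub], of ?f])
    show "bij_betw ?f (verts (monochromatic D \<phi> W)) (verts (H \<restriction> ?f ` W))"
      by (auto simp: bij_betw_def inj_on_def)
    show "(u, w) \<in> arcs_ends (monochromatic D \<phi> W) \<longleftrightarrow> (?f u, ?f w) \<in> arcs_ends (H \<restriction> ?f ` W)"
      if "u \<in> verts (monochromatic D \<phi> W)" "w \<in> verts (monochromatic D \<phi> W)" for u w
      using that \<phi> by (auto simp: arcs_ends_monochromatic arcs_ends_induce H(1) list_cover_def)
  qed
  then show ?thesis using has_property_iso[OF digraph_monochromatic[OF D W]] by blast
qed

text \<open>Criticality of the list cover rephrased for colour functions, so that the cover itself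
  no longer occurs.\<close>

locale list_critical =
  fixes P :: digraph_property and D :: "('a, 'b) pre_digraph" and L :: "'a \<Rightarrow> 'c set"
  assumes reliable: "reliable P" and digraph: "digraph D"
    and finite_L: "v \<in> verts D \<Longrightarrow> finite (L v)"
    and not_colourable: "(\<And>v. v \<in> verts D \<Longrightarrow> \<phi> v \<in> L v) \<Longrightarrow>
      \<not> has_property P (monochromatic D \<phi> (verts D))"
    and critical: "v \<in> verts D \<Longrightarrow> \<exists>\<phi>. (\<forall>w \<in> verts D - {v}. \<phi> w \<in> L w) \<and>
      has_property P (monochromatic D \<phi> (verts D - {v}))"
begin

text \<open>The value at \<open>v\<close> is left free, matching the junk value at the hole in
  \<open>sliding\<close>.\<close>

definition partial_colouring :: "'a \<Rightarrow> ('a \<Rightarrow> 'c) \<Rightarrow> bool" where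
  "partial_colouring v \<phi> \<longleftrightarrow> v \<in> verts D \<and> (\<forall>w \<in> verts D - {v}. \<phi> w \<in> L w) \<and>
     has_property P (monochromatic D \<phi> (verts D - {v}))"

definition low :: "'a set" where
  "low = {v \<in> verts D. out_degree D v = d_out P * card (L v) \<and> in_degree D v = d_in P * card (L v)}"

text \<open>
  Pairing each arc relation with its degree bound lets one argument cover out- and in-neighbours. This
  is a relation, not a function of the arc relation: \<open>arcs_ends D\<close> may be symmetric.
\<close>

definition directions :: "(('a \<times> 'a) set \<times> nat) set" where
  "directions = {(arcs_ends D, d_out P), ((arcs_ends D)\<inverse>, d_in P)}"

section \<open>Colours around low vertices\<close>

lemma directions_in_verts: "(R, k) \<in> directions \<Longrightarrow> R \<subseteq> verts D \<times> verts D"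
  using arcs_ends_in_verts[OF digraph] by (auto simp: directions_def)

lemma directions_irrefl: "(R, k) \<in> directions \<Longrightarrow> (u, u) \<notin> R"
  using no_loop_arcs_ends[OF digraph] by (auto simp: directions_def)

lemma finite_neighbours: "(R, k) \<in> directions \<Longrightarrow> finite (R `` {v})"
  by (rule finite_subset[OF _ finite_verts_digraph[OF digraph]]) (use directions_in_verts in auto)

lemma degree_low:
  assumes "v \<in> low" "(R, k) \<in> directions"
  shows "card (R `` {v}) = k * card (L v)"
  using assms by (auto simp: low_def directions_def out_degree_conv[OF digraph] in_degree_conv[OF digraph])

text \<open>This is \<open>ex_CR_induced\<close> for a monochromatic digraph. Its degrees count
  neighbours of the same colour inside \<open>U\<close>, so \<open>CR_degrees\<close> becomes a
  lower bound on such neighbours.\<close>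

lemma ex_critical_set:
  assumes W: "W \<subseteq> verts D" and neg: "\<not> has_property P (monochromatic D \<phi> W)"
  obtains U where "U \<subseteq> W" "\<And>Y. Y \<subseteq> W \<Longrightarrow> has_property P (monochromatic D \<phi> Y) \<Longrightarrow> \<not> U \<subseteq> Y"
    "\<And>R k w. (R, k) \<in> directions \<Longrightarrow> w \<in> U \<Longrightarrow> k \<le> card {u \<in> R `` {w} \<inter> U. \<phi> u = \<phi> w}"
proof -
  have dW: "digraph (monochromatic D \<phi> W)" by (rule digraph_monochromatic[OF digraph W])
  obtain U where U: "U \<subseteq> W" "CR P (monochromatic D \<phi> W \<restriction> U)"
      "\<And>Y. Y \<subseteq> W \<Longrightarrow> has_property P (monochromatic D \<phi> W \<restriction> Y) \<Longrightarrow> \<not> U \<subseteq> Y"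
    by (rule ex_CR_induced[OF reliable dW neg]) (rule that; simp)
  have CR: "CR P (monochromatic D \<phi> U)" using U(2) monochromatic_induce[OF U(1)] by metis
  have dU: "digraph (monochromatic D \<phi> U)" using CR by (simp add: CR_def)
  have deg: "k \<le> card {u \<in> R `` {w} \<inter> U. \<phi> u = \<phi> w}" if R: "(R, k) \<in> directions" and w: "w \<in> U" for R k w
  proof -
    have "arcs_ends (monochromatic D \<phi> U) `` {w} = {u \<in> arcs_ends D `` {w} \<inter> U. \<phi> u = \<phi> w}"
      "(arcs_ends (monochromatic D \<phi> U))\<inverse> `` {w} = {u \<in> (arcs_ends D)\<inverse> `` {w} \<inter> U. \<phi> u = \<phi> w}"
      using w by (auto simp: arcs_ends_monochromatic)
    then show ?thesis
      using R CR_degrees[OF reliable CR, of w] w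
      by (auto simp: directions_def out_degree_conv[OF dU] in_degree_conv[OF dU])
  qed
  have "\<not> U \<subseteq> Y" if "Y \<subseteq> W" "has_property P (monochromatic D \<phi> Y)" for Y
    using U(3)[OF that(1)] that(2) unfolding monochromatic_induce[OF that(1)] .
  from that[OF U(1) this deg] show thesis by blast
qed

text \<open>Giving \<open>v\<close> the colour \<open>c\<close> produces a nonmember. Its critical
  set cannot avoid \<open>v\<close>, because the colouring without \<open>v\<close> is admissible,
  and the degree bound applies at \<open>v\<close>.\<close>

lemma neighbours_of_colour_ge:
  assumes \<phi>: "partial_colouring v \<phi>" and c: "c \<in> L v" and R: "(R, k) \<in> directions"
  shows "k \<le> card {u \<in> R `` {v}. \<phi> u = c}"
proof -
  let ?\<psi> = "\<phi>(v := c)" and ?Y = "verts D - {v}"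
  have "\<not> has_property P (monochromatic D ?\<psi> (verts D))"
    using \<phi> c by (intro not_colourable) (auto simp: partial_colouring_def)
  then obtain U where U: "U \<subseteq> verts D"
      "\<And>Y. Y \<subseteq> verts D \<Longrightarrow> has_property P (monochromatic D ?\<psi> Y) \<Longrightarrow> \<not> U \<subseteq> Y"
      "\<And>R k w. (R, k) \<in> directions \<Longrightarrow> w \<in> U \<Longrightarrow> k \<le> card {u \<in> R `` {w} \<inter> U. ?\<psi> u = ?\<psi> w}"
    by (rule ex_critical_set[OF order_refl]) (rule that; assumption)
  have "monochromatic D ?\<psi> ?Y = monochromatic D \<phi> ?Y" by (rule monochromatic_cong) auto
  then have "\<not> U \<subseteq> ?Y" using U(2)[of ?Y] \<phi> by (auto simp: partial_colouring_def)
  then have "v \<in> U" using U(1) by blast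
  from U(3)[OF R this] have "k \<le> card {u \<in> R `` {v} \<inter> U. ?\<psi> u = c}" by simp
  also have "\<dots> \<le> card {u \<in> R `` {v}. \<phi> u = c}"
    using directions_irrefl[OF R]
    by (intro card_mono finite_subset[OF _ finite_neighbours[OF R]]) auto
  finally show ?thesis .
qed

text \<open>Each colour of the list occurs at least \<open>k\<close> times among the neighbours, and
  there are only \<open>k * card (L v)\<close> of them. So every bound is an equality and no room is
  left for a colour outside the list.\<close>

lemma low_neighbours:
  assumes \<phi>: "partial_colouring v \<phi>" and v: "v \<in> low" and R: "(R, k) \<in> directions"
  shows "c \<in> L v \<Longrightarrow> card {u \<in> R `` {v}. \<phi> u = c} = k"
    and "u \<in> R `` {v} \<Longrightarrow> \<phi> u \<in> L v"
proof -
  let ?N = "R `` {v}"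
  let ?n = "\<lambda>c. card {u \<in> ?N. \<phi> u = c}"
  have finN: "finite ?N" by (rule finite_neighbours[OF R])
  have finL: "finite (L v)" using finite_L v by (auto simp: low_def)
  have "(\<Sum>c\<in>L v. ?n c) = card (\<Union>c\<in>L v. {u \<in> ?N. \<phi> u = c})"
    by (intro card_UN_disjoint[symmetric] ballI impI finL finite_subset[OF _ finN]) auto
  also have "(\<Union>c\<in>L v. {u \<in> ?N. \<phi> u = c}) = {u \<in> ?N. \<phi> u \<in> L v}" by auto
  finally have sum: "(\<Sum>c\<in>L v. ?n c) = card {u \<in> ?N. \<phi> u \<in> L v}" .
  have le: "card {u \<in> ?N. \<phi> u \<in> L v} \<le> card ?N" using finN by (intro card_mono) auto
  have const: "card ?N = (\<Sum>c\<in>L v. k)" using degree_low[OF v R] by (simp add: mult.commute)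
  have ge: "k \<le> ?n c" if "c \<in> L v" for c by (rule neighbours_of_colour_ge[OF \<phi> that R])
  then have "(\<Sum>c\<in>L v. k) \<le> (\<Sum>c\<in>L v. ?n c)" by (intro sum_mono)
  then have eq: "(\<Sum>c\<in>L v. ?n c) = (\<Sum>c\<in>L v. k)" "card {u \<in> ?N. \<phi> u \<in> L v} = card ?N"
    using sum le const by linarith+
  show "?n c = k" if c: "c \<in> L v"
  proof (rule ccontr)
    assume "?n c \<noteq> k"
    then have "k < ?n c" using ge[OF c] by simp
    then have "(\<Sum>c\<in>L v. k) < (\<Sum>c\<in>L v. ?n c)"
      using finL ge c by (intro sum_strict_mono_ex1) auto
    then show False using eq by simp
  qed
  have "{u \<in> ?N. \<phi> u \<in> L v} = ?N" using eq(2) finN by (intro card_subset_eq) auto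
  then show "\<phi> u \<in> L v" if "u \<in> ?N" using that by blast
qed

text \<open>By \<open>low_neighbours\<close> the multiplicity of each colour depends on
  \<open>L v\<close> and \<open>k\<close> alone.\<close>

lemma low_colour_multiset:
  assumes "partial_colouring v \<phi>" "partial_colouring v \<psi>" "v \<in> low" "(R, k) \<in> directions"
  shows "image_mset \<phi> (mset_set (R `` {v})) = image_mset \<psi> (mset_set (R `` {v}))"
proof (rule multiset_eqI)
  fix c
  have fin: "finite (R `` {v})" by (rule finite_neighbours[OF assms(4)])
  have "count (image_mset \<chi> (mset_set (R `` {v}))) c = (if c \<in> L v then k else 0)"
    if \<chi>: "partial_colouring v \<chi>" for \<chi>
  proof -
    have *: "count (image_mset \<chi> (mset_set (R `` {v}))) c = card {u \<in> R `` {v}. \<chi> u = c}"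
      by (rule count_image_mset_eq_card_vimage[OF fin])
    show ?thesis
    proof (cases "c \<in> L v")
      case False
      then have "{u \<in> R `` {v}. \<chi> u = c} = {}" using low_neighbours(2)[OF \<chi> assms(3,4)] by blast
      then show ?thesis unfolding * using False by (simp only: card.empty if_False)
    qed (use * low_neighbours(1)[OF \<chi> assms(3,4)] in simp)
  qed
  then show "count (image_mset \<phi> (mset_set (R `` {v}))) c = count (image_mset \<psi> (mset_set (R `` {v}))) c"
    using assms(1,2) by simp
qed

text \<open>If the new colouring failed, a critical set would contain \<open>v\<close> but not
  \<open>u\<close>. It would need \<open>k\<close> neighbours of \<open>v\<close> with the colour of
  \<open>u\<close>, but in this direction there are exactly \<open>k\<close>, and \<open>u\<close>
  is one of them.\<close>

lemma slide_into_low: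
  assumes \<phi>: "partial_colouring v \<phi>" and v: "v \<in> low" and u: "(R, k) \<in> directions" "u \<in> R `` {v}"
  shows "partial_colouring u (\<phi>(v := \<phi> u))"
proof -
  let ?\<psi> = "\<phi>(v := \<phi> u)" and ?W = "verts D - {u}"
  have uD: "u \<in> verts D" using u directions_in_verts by blast
  have c: "\<phi> u \<in> L v" by (rule low_neighbours(2)[OF \<phi> v u])
  have "has_property P (monochromatic D ?\<psi> ?W)"
  proof (rule ccontr)
    assume "\<not> ?thesis"
    then obtain U where U: "U \<subseteq> ?W"
        "\<And>Y. Y \<subseteq> ?W \<Longrightarrow> has_property P (monochromatic D ?\<psi> Y) \<Longrightarrow> \<not> U \<subseteq> Y"
        "\<And>R k w. (R, k) \<in> directions \<Longrightarrow> w \<in> U \<Longrightarrow> k \<le> card {x \<in> R `` {w} \<inter> U. ?\<psi> x = ?\<psi> w}"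
      by (rule ex_critical_set[OF Diff_subset]) (rule that; assumption)
    let ?Y = "verts D - {u, v}"
    have "monochromatic D ?\<psi> ?Y = monochromatic D \<phi> ?Y" by (rule monochromatic_cong) auto
    also have "\<dots> = monochromatic D \<phi> (verts D - {v}) \<restriction> ?Y"
      by (rule monochromatic_induce[symmetric]) auto
    finally have eq: "monochromatic D ?\<psi> ?Y = monochromatic D \<phi> (verts D - {v}) \<restriction> ?Y" .
    have "has_property P (monochromatic D ?\<psi> ?Y)"
      unfolding eq using \<phi>
      by (intro has_property_hereditary[OF reliable digraph_monochromatic[OF digraph]])
        (auto simp: partial_colouring_def)
    then have "\<not> U \<subseteq> ?Y" using U(2)[of ?Y] by blast
    then have "v \<in> U" using U(1) by blast
    from U(3)[OF u(1) this] have "k \<le> card {x \<in> R `` {v} \<inter> U. ?\<psi> x = \<phi> u}" by simp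
    also have "\<dots> < card {x \<in> R `` {v}. \<phi> x = \<phi> u}"
      using directions_irrefl[OF u(1)] U(1) u(2)
      by (intro psubset_card_mono finite_subset[OF _ finite_neighbours[OF u(1), of v]]) auto
    also have "\<dots> = k" by (rule low_neighbours(1)[OF \<phi> v u(1) c])
    finally show False by simp
  qed
  then show ?thesis using \<phi> c uD by (auto simp: partial_colouring_def)
qed

section \<open>Blocks of the low vertex subdigraph\<close>

theorem dibrick_block:
  assumes B: "is_block (D \<restriction> low) B"
  shows "dibrick P B"
proof -
  let ?V = "verts B" and ?A = "arcs_ends B"
  have dG: "digraph (D \<restriction> low)" by (rule digraph_induce[OF digraph]) (auto simp: low_def)
  have V: "?V \<subseteq> low" "?V \<subseteq> verts D"
    using block_induced(1)[OF dG B] by (auto simp: low_def)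
  have dB: "digraph B"
    using block_induced[OF dG B] digraph_induce[OF dG] by metis
  have "arcs_ends B = arcs_ends (D \<restriction> low) \<inter> ?V \<times> ?V"
    using arg_cong[OF block_induced(2)[OF dG B], of arcs_ends] unfolding arcs_ends_induce .
  then have A: "?A = arcs_ends D \<inter> ?V \<times> ?V" using V(1) by (auto simp: arcs_ends_induce)
  have conn: "connected B" using B by (auto simp: is_block_def pre_digraph.max_subgraph_def)
  then obtain v0 where v0: "v0 \<in> ?V" by (auto simp: connected_conv)
  obtain \<phi>0 where \<phi>0: "partial_colouring v0 \<phi>0"
    using critical[of v0] v0 V by (auto simp: partial_colouring_def)
  have finV: "finite ?V" by (rule finite_verts_digraph[OF dB])
  have restrict: "\<exists>R k. (R, k) \<in> directions \<and> R' = R \<inter> ?V \<times> ?V" if "R' = ?A \<or> R' = ?A\<inverse>" for R'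
    using that
  proof
    assume "R' = ?A"
    then show ?thesis
      using A by (intro exI[of _ "arcs_ends D"] exI[of _ "d_out P"]) (simp add: directions_def)
  next
    assume "R' = ?A\<inverse>"
    then have "R' = (arcs_ends D)\<inverse> \<inter> ?V \<times> ?V" using A by blast
    then show ?thesis
      by (intro exI[of _ "(arcs_ends D)\<inverse>"] exI[of _ "d_in P"]) (simp add: directions_def)
  qed
  have adj_dir: "\<exists>R k. (R, k) \<in> directions \<and> u \<in> R `` {v}" if "(u, v) \<in> ?A \<or> (v, u) \<in> ?A" for u v
    using that restrict[of ?A] restrict[of "?A\<inverse>"] by blast
  \<comment> \<open>Outside the block all colourings are fixed to \<open>\<phi>0\<close>, so
    neighbours there cancel and the invariance of the colour multisets restricts to the
    block.\<close>
  define S where "S v \<phi> \<longleftrightarrow> v \<in> ?V \<and> partial_colouring v \<phi> \<and> (\<forall>w. w \<notin> ?V \<longrightarrow> \<phi> w = \<phi>0 w)"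
    for v \<phi>
  interpret sliding ?V ?A S
  proof
    show "finite ?V" by (rule finV)
    show "?A \<subseteq> ?V \<times> ?V" by (rule arcs_ends_in_verts[OF dB])
    show "(u, u) \<notin> ?A" for u by (rule no_loop_arcs_ends[OF dB])
    show "\<exists>us. us \<noteq> [] \<and> hd us = x \<and> last us = y \<and> set us \<subseteq> ?V - Z \<and>
        successively (\<lambda>u v. (u, v) \<in> ?A \<or> (v, u) \<in> ?A) us"
      if "x \<in> ?V" "y \<in> ?V" "Z = {} \<or> Z = {z}" "x \<notin> Z" "y \<notin> Z" for x y Z z
      using block_path_avoiding[OF dG B that] .
    show "v \<in> ?V" if "S v \<phi>" for v \<phi> using that by (simp add: S_def)
    show "S u (\<phi>(v := \<phi> u))" if "S v \<phi>" and arc: "(u, v) \<in> ?A \<or> (v, u) \<in> ?A" for u v \<phi>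
    proof -
      have \<phi>: "partial_colouring v \<phi>" "v \<in> ?V" "\<forall>w. w \<notin> ?V \<longrightarrow> \<phi> w = \<phi>0 w"
        using that(1) by (auto simp: S_def)
      obtain R k where "(R, k) \<in> directions" "u \<in> R `` {v}" using adj_dir[OF arc] by blast
      from slide_into_low[OF \<phi>(1) _ this] have "partial_colouring u (\<phi>(v := \<phi> u))" using \<phi>(2) V by blast
      moreover have "u \<in> ?V" using arc arcs_ends_in_verts[OF dB] by blast
      ultimately show ?thesis using \<phi>(2,3) by (auto simp: S_def)
    qed
    show "image_mset \<phi> (mset_set (R' `` {v})) = image_mset \<psi> (mset_set (R' `` {v}))"
      if S: "S v \<phi>" "S v \<psi>" and R': "R' = ?A \<or> R' = ?A\<inverse>" for v \<phi> \<psi> R'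
    proof -
      obtain R k where R: "(R, k) \<in> directions" "R' = R \<inter> ?V \<times> ?V" using restrict[OF R'] by blast
      have v: "v \<in> ?V" using S(1) by (simp add: S_def)
      have R'v: "R' `` {v} = R `` {v} \<inter> ?V" using R(2) v by blast
      have fin: "finite (R `` {v})" by (rule finite_neighbours[OF R(1)])
      have split: "mset_set (R `` {v}) = mset_set (R `` {v} \<inter> ?V) + mset_set (R `` {v} - ?V)"
        using fin by (subst mset_set_Union[symmetric]) (auto simp: Int_Diff_Un)
      have "image_mset \<phi> (mset_set (R `` {v} - ?V)) = image_mset \<psi> (mset_set (R `` {v} - ?V))"
        using S fin by (intro image_mset_cong) (auto simp: S_def)
      moreover have "image_mset \<phi> (mset_set (R `` {v})) = image_mset \<psi> (mset_set (R `` {v}))"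
        using S v V(1) by (intro low_colour_multiset[OF _ _ _ R(1)]) (auto simp: S_def)
      ultimately show ?thesis unfolding R'v split by simp
    qed
  qed
  show ?thesis
  proof (cases "\<forall>u\<in>?V. \<forall>w\<in>?V. u \<noteq> w \<longrightarrow> (u, w) \<in> ?A")
    case True
    then have "digraph_iso B (with_proj (bidirected_complete (card ?V)))"
      using iso_bidirected_complete[OF dB] by blast
    moreover have "1 \<le> card ?V" using v0 finV card_gt_0_iff[of ?V] by force
    ultimately show ?thesis using dB conn unfolding dibrick_def by blast
  next
    case not_complete: False
    then obtain p q where pq: "p \<in> ?V" "q \<in> ?V" "p \<noteq> q" by blast
    show ?thesis
    proof (cases "\<exists>v \<phi> x y. S v \<phi> \<and> x \<in> ?V \<and> y \<in> ?V \<and> x \<noteq> v \<and> y \<noteq> v \<and> \<phi> x \<noteq> \<phi> y")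
      case True
      then obtain v \<phi> x y where "S v \<phi>" "x \<in> ?V" "y \<in> ?V" "x \<noteq> v" "y \<noteq> v" "\<phi> x \<noteq> \<phi> y"
        by blast
      from nonconstant_imp_complete_or_odd_cycle[OF this] not_complete obtain c
        where c: "distinct c" "set c = ?V" "odd (length c)" "3 \<le> length c"
          "\<And>i j. i < length c \<Longrightarrow> j < length c \<Longrightarrow> (c ! i, c ! j) \<in> ?A \<longleftrightarrow>
            [j = Suc i] (mod length c) \<or> [i = Suc j] (mod length c)"
        by blast
      have "digraph_iso B (with_proj (bidirected_cycle (length c)))"
        by (rule iso_bidirected_cycle[OF dB c(1,2,4,5)])
      then show ?thesis using dB conn c(3,4) unfolding dibrick_def by blast
    next
      case False
      have neighbour: "\<exists>u. adj v u" if v: "v \<in> ?V" for v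
      proof -
        obtain w where w: "w \<in> ?V" "w \<noteq> v" using pq by metis
        obtain us where us: "us \<noteq> []" "hd us = v" "last us = w" "successively adj us"
          using path_between[OF v w(1), of "{}"] by blast
        then obtain us' where "us = v # us'" "us' \<noteq> []" using w(2) by (metis last_ConsL list.exhaust_sel)
        then show ?thesis using us(4) by (auto simp: successively_Cons)
      qed
      have S0: "S v0 \<phi>0" using v0 \<phi>0 by (simp add: S_def)
      obtain u where u: "adj v0 u" using neighbour[OF v0] by blast
      then have uV: "u \<in> ?V" "u \<noteq> v0" using adj_in_V adj_irrefl by blast+
      \<comment> \<open>Every colouring is constant on the block away from its hole. Filling the
        hole \<open>v0\<close> with that colour makes \<open>\<phi>\<close> constant on the whole
        block, so slides leave it unchanged and it serves for every hole.\<close>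
      define c where "c = \<phi>0 u"
      define \<phi> where "\<phi> = \<phi>0(v0 := c)"
      have const: "\<phi> w = c" if "w \<in> ?V" for w
        using that False S0 uV unfolding \<phi>_def c_def by auto
      have step: "S y \<phi>" if "S x \<phi>" "adj x y" for x y
      proof -
        have "\<phi>(x := \<phi> y) = \<phi>" using const adj_in_V[OF that(2)] by (auto simp: fun_eq_iff)
        then show ?thesis using slide_adj[OF that] by simp
      qed
      \<comment> \<open>Sliding from \<open>v0\<close> to \<open>u\<close> turns
        \<open>\<phi>0\<close> into \<open>\<phi>\<close>; sliding back yields \<open>\<phi>\<close>
        with its hole at \<open>v0\<close>.\<close>
      have "S u \<phi>" using slide_adj[OF S0 u] by (simp add: \<phi>_def c_def)
      then have S0': "S v0 \<phi>" using step u adj_sym by blast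
      have S: "S w \<phi>" if w: "w \<in> ?V" for w
      proof -
        have walk: "S (last us) \<phi>" if "us \<noteq> []" "successively adj us" "S (hd us) \<phi>" for us
          using that
        proof (induction us rule: rev_induct)
          case (snoc y ys)
          then show ?case using step by (cases "ys = []") (auto simp: successively_append_iff)
        qed simp
        show ?thesis using path_between[OF v0 w, of "{}"] walk S0' by blast
      qed
      \<comment> \<open>All neighbours inside the block have the colour \<open>c\<close>, and a low
        vertex has exactly \<open>k\<close> neighbours of each colour in its list.\<close>
      have deg: "card (R `` {w} \<inter> ?V) \<le> k" if w: "w \<in> ?V" and R: "(R, k) \<in> directions" for w R k
      proof -
        have pc: "partial_colouring w \<phi>" "w \<in> low" using S[OF w] w V by (auto simp: S_def)
        obtain x where x: "adj w x" using neighbour[OF w] by blast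
        then obtain R' k' where "(R', k') \<in> directions" "x \<in> R' `` {w}"
          using adj_dir[of x w] by (auto simp: adj_def)
        from low_neighbours(2)[OF pc this] have "c \<in> L w" using const adj_in_V[OF x] by simp
        then have "card {u \<in> R `` {w}. \<phi> u = c} = k" by (rule low_neighbours(1)[OF pc R])
        moreover have "card (R `` {w} \<inter> ?V) \<le> card {u \<in> R `` {w}. \<phi> u = c}"
          using const by (intro card_mono finite_subset[OF _ finite_neighbours[OF R, of w]]) auto
        ultimately show ?thesis by simp
      qed
      have out: "out_degree B w \<le> d_out P" and in': "in_degree B w \<le> d_in P" if w: "w \<in> ?V" for w
      proof -
        have "?A `` {w} = arcs_ends D `` {w} \<inter> ?V" "?A\<inverse> `` {w} = (arcs_ends D)\<inverse> `` {w} \<inter> ?V"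
          using A w by blast+
        then show "out_degree B w \<le> d_out P" "in_degree B w \<le> d_in P"
          using deg[OF w, of "arcs_ends D" "d_out P"] deg[OF w, of "(arcs_ends D)\<inverse>" "d_in P"]
          by (simp_all add: directions_def out_degree_conv[OF dB] in_degree_conv[OF dB])
      qed
      show ?thesis
      proof (cases "has_property P B")
        case True
        have "max_out_degree B \<le> d_out P" "max_in_degree B \<le> d_in P"
          unfolding max_out_degree_def max_in_degree_def
          by (rule Max.boundedI; use out in' v0 finV in blast)+
        then show ?thesis using True dB conn unfolding dibrick_def by blast
      next
        case no_property: False
        obtain U where U: "U \<noteq> {}" "U \<subseteq> ?V" "CR P (B \<restriction> U)"
          by (rule ex_CR_induced[OF reliable dB no_property]) (rule that; assumption)
        have dU: "digraph (B \<restriction> U)" by (rule digraph_induce[OF dB U(2)])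
        \<comment> \<open>In the critical digraph on \<open>U\<close> the degrees are at least those
          of the property, in \<open>B\<close> they are at most those; so \<open>U\<close> contains
          all neighbours in \<open>B\<close> of its vertices.\<close>
        have closed: "x \<in> U" if w: "w \<in> U" and x: "adj w x" for w x
        proof -
          have wV: "w \<in> ?V" using w U(2) by blast
          have fin: "finite (?A `` {w})" "finite (?A\<inverse> `` {w})"
            by (rule finite_subset[OF _ finV]; use arcs_ends_in_verts[OF dB] in blast)+
          have eq: "arcs_ends (B \<restriction> U) `` {w} = ?A `` {w} \<inter> U"
              "(arcs_ends (B \<restriction> U))\<inverse> `` {w} = ?A\<inverse> `` {w} \<inter> U"
            using w by (auto simp: arcs_ends_induce)
          have "card (?A `` {w}) \<le> card (?A `` {w} \<inter> U)" "card (?A\<inverse> `` {w}) \<le> card (?A\<inverse> `` {w} \<inter> U)"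
            using CR_degrees[OF reliable U(3), of w] w out[OF wV] in'[OF wV]
            unfolding out_degree_conv[OF dU] in_degree_conv[OF dU] eq out_degree_conv[OF dB] in_degree_conv[OF dB]
            by auto
          then have "?A `` {w} \<inter> U = ?A `` {w}" "?A\<inverse> `` {w} \<inter> U = ?A\<inverse> `` {w}"
            by (auto dest: card_seteq[OF fin(1) Int_lower1] card_seteq[OF fin(2) Int_lower1])
          then show ?thesis using x by (auto simp: adj_def)
        qed
        have "U = ?V"
        proof (intro equalityI subsetI)
          fix x assume x: "x \<in> ?V"
          obtain w where w: "w \<in> U" using U(1) by blast
          have walk: "last us \<in> U" if "us \<noteq> []" "successively adj us" "hd us \<in> U" for us
            using that
          proof (induction us rule: rev_induct)
            case (snoc y ys)
            then show ?case using closed by (cases "ys = []") (auto simp: successively_append_iff)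
          qed simp
          have "w \<in> ?V" using w U(2) by blast
          from path_between[OF this x, of "{}"] walk w show "x \<in> U" by blast
        qed (use U(2) in blast)
        then have CR: "CR P B" using U(3) induce_verts[OF wf_digraphI[OF dB]] by simp
        have eq: "out_degree B w = d_out P" "in_degree B w = d_in P" if "w \<in> ?V" for w
          using CR_degrees[OF reliable CR that] out[OF that] in'[OF that] by simp_all
        \<comment> \<open>Counting the arcs by tails and by heads will equate the two degrees of the
          property.\<close>
        have count: "card R = (\<Sum>w\<in>?V. card (R `` {w}))" if "R \<subseteq> ?V \<times> ?V" for R
        proof -
          have "R = (SIGMA w:?V. R `` {w})" using that by auto
          moreover have "finite (R `` {w})" for w
            by (rule finite_subset[OF _ finV]) (use that in blast)
          ultimately show ?thesis using finV card_SigmaI[of ?V "\<lambda>w. R `` {w}"] by simp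
        qed
        have "card ?V * d_out P = card ?A"
          using count[of ?A] arcs_ends_in_verts[OF dB] eq(1) by (simp add: out_degree_conv[OF dB])
        also have "card ?A = card (?A\<inverse>)" by simp
        also have "\<dots> = card ?V * d_in P"
          using count[of "?A\<inverse>"] arcs_ends_in_verts[OF dB] eq(2) by (auto simp: in_degree_conv[OF dB])
        finally have "d_out P = d_in P" using v0 finV by auto
        then show ?thesis
          using CR dB conn eq unfolding dibrick_def eulerian_def by auto
      qed
    qed
  qed
qed

end

section \<open>From transversals of a critical list cover to colourings\<close>

theorem theorem9:
  fixes P :: digraph_property
    and D :: "('a, 'b) pre_digraph"
    and L :: "'a \<Rightarrow> 'c set"
    and X :: "'a \<Rightarrow> ('a \<times> 'c) set"
    and H :: "('a \<times> 'c, ('a \<times> 'c) \<times> ('a \<times> 'c)) pre_digraph"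
    and B :: "('a, 'b) pre_digraph"
  assumes "reliable P"
    and "digraph D"
    and "(X, H) = list_cover D L"
    and "critical_cover P D X H"
    and "is_block (low_vertex_subdigraph P D X) B"
  shows "dibrick P B"
proof -
  have X: "X v = {v} \<times> L v" for v using assms(3) by (simp add: list_cover_def)
  have H: "H = snd (list_cover D L)" using arg_cong[OF assms(3), of snd] by simp
  have vH: "verts H = (SIGMA v : verts D. L v)" by (simp add: H list_cover_def)
  have dH: "digraph H" using assms(4) by (simp add: critical_cover_def is_cover_def)
  \<comment> \<open>The finite vertex set of the cover contains a copy of each list.\<close>
  have finL: "finite (L v)" if "v \<in> verts D" for v
  proof -
    have "Pair v ` L v \<subseteq> verts H" using that by (auto simp: vH)
    then have "finite (Pair v ` L v)" using finite_subset finite_verts_digraph[OF dH] by blast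
    then show ?thesis by (rule finite_imageD) (simp add: inj_on_def)
  qed
  interpret list_critical P D L
  proof (rule list_critical.intro)
    show "reliable P" "digraph D" by fact+
    show "finite (L v)" if "v \<in> verts D" for v using finL[OF that] .
    show "\<not> has_property P (monochromatic D \<phi> (verts D))" if \<phi>: "\<And>v. v \<in> verts D \<Longrightarrow> \<phi> v \<in> L v" for \<phi>
    proof
      let ?T = "(\<lambda>w. (w, \<phi> w)) ` verts D"
      assume "has_property P (monochromatic D \<phi> (verts D))"
      then have "has_property P (H \<restriction> ?T)"
        using has_property_list_cover[OF assms(2) order_refl H dH \<phi>] by simp
      moreover have "?T \<inter> X v = {(v, \<phi> v)}" if "v \<in> verts D" for v
        unfolding X using that \<phi>[OF that] by blast
      then have "transversal D X H ?T" unfolding transversal_def vH using \<phi> by simp blast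
      ultimately show False using assms(4) unfolding critical_cover_def property_transversal_def by blast
    qed
    show "\<exists>\<phi>. (\<forall>w \<in> verts D - {v}. \<phi> w \<in> L w) \<and> has_property P (monochromatic D \<phi> (verts D - {v}))"
      if v: "v \<in> verts D" for v
    proof -
      let ?W = "verts D - {v}"
      obtain T where T: "partial_transversal D X H T" "dom_of D X T = ?W" "has_property P (H \<restriction> T)"
        using assms(4) v unfolding critical_cover_def property_transversal_avoiding_def by blast
      \<comment> \<open>An infinite intersection with \<open>X w\<close> would have
        \<open>card\<close> 0 and pass the bound of \<open>partial_transversal\<close>; finiteness
        of \<open>T\<close> excludes it.\<close>
      have finT: "finite T"
        using T(1) finite_subset finite_verts_digraph[OF dH] by (auto simp: partial_transversal_def)
      \<comment> \<open>The colour of \<open>w\<close> is read off from the only vertex of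
        \<open>T\<close> above \<open>w\<close>.\<close>
      have "\<forall>w\<in>?W. \<exists>c. c \<in> L w \<and> T \<inter> X w = {(w, c)}"
      proof
        fix w assume w: "w \<in> ?W"
        have "X w \<inter> T \<noteq> {}" using w unfolding T(2)[symmetric] dom_of_def by blast
        then have "0 < card (T \<inter> X w)" using finT by (simp add: card_gt_0_iff Int_commute)
        moreover have "card (T \<inter> X w) \<le> 1" using w T(1) by (simp add: partial_transversal_def)
        ultimately have "card (T \<inter> X w) = 1" by linarith
        then obtain t where t: "T \<inter> X w = {t}" by (rule card_1_singletonE)
        then have "t \<in> {w} \<times> L w" unfolding X by blast
        then show "\<exists>c. c \<in> L w \<and> T \<inter> X w = {(w, c)}" using t by auto
      qed
      from bchoice[OF this] obtain \<phi>
        where \<phi>: "\<And>w. w \<in> ?W \<Longrightarrow> \<phi> w \<in> L w \<and> T \<inter> X w = {(w, \<phi> w)}" by blast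
      have T_eq: "T = (\<lambda>w. (w, \<phi> w)) ` ?W"
      proof (intro equalityI subsetI)
        fix t assume t: "t \<in> T"
        then have "t \<in> verts H" using T(1) by (auto simp: partial_transversal_def)
        then obtain w c where w: "t = (w, c)" "w \<in> verts D" "t \<in> X w" by (auto simp: vH X)
        then have "w \<in> ?W" using t unfolding T(2)[symmetric] dom_of_def by blast
        then show "t \<in> (\<lambda>w. (w, \<phi> w)) ` ?W" using \<phi> t w by blast
      qed (use \<phi> in blast)
      then have "has_property P (monochromatic D \<phi> ?W)"
        using T(3) has_property_list_cover[OF assms(2) Diff_subset H dH, of "{v}" \<phi> P] \<phi>
        unfolding T_eq by blast
      then show ?thesis using \<phi> by blast
    qed
  qed
  \<comment> \<open>Low vertices are defined through \<open>X v\<close>, which is a copy of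
    \<open>L v\<close> of the same size.\<close>
  have "low_vertices P D X = low"
    unfolding low_vertices_def low_def deg_def X card_cartesian_product by simp
  then show ?thesis using dibrick_block assms(5) by (simp add: low_vertex_subdigraph_def)
qed

end
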